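(* Let $n\ge 4$ and let $\mathscr{U}_n$ be the set of all bipartite unicyclic graphs on $n$ vertices. (i) For every $G\in\mathscr{U}_n$, $\operatorname{per} L(G)\ge 24n-60$, with equality if and only if $G\cong B(2,n-2)$. (ii) If $n\ge 6$, then for every $G\in\mathscr{U}_n$ not isomorphic to $B(2,n-2)$, $\operatorname{per} L(G)\ge 40n-140$, with equality if and only if $G\cong C_4(1^10,1^00,1^{n-5}0,1^00)$. (iii) If $n\ge 6$, then for every $G\in\mathscr{U}_n$ isomorphic to neither $B(2,n-2)$ nor $C_4(1^10,1^00,1^{n-5}0,1^00)$, $\operatorname{per} L(G)\ge 44n-160$, with equality if and only if $G\cong B(3,n-3)$.
   Context: For a simple graph $G$, $L(G)=D(G)-A(G)$ is its Laplacian matrix ($D(G)$ the diagonal degree matrix, $A(G)$ the adjacency matrix), and $\operatorname{per} X=\sum_{\sigma\in S_n}\prod_{t=1}^n x_{t\sigma(t)}$ is the permanent. A unicyclic graph is a connected graph with the same number of vertices and edges. For nonnegative integers $s_i,k_i$, $C_4(1^{s_1}k_1,1^{s_2}k_2,1^{s_3}k_3,1^{s_4}k_4)$ is the graph obtained from the 4-cycle $v_1v_2v_3v_4v_1$ by attaching $s_i$ pendant vertices at $v_i$ and, when $k_i\ge 1$, joining $v_i$ by an edge to the center of a star on $k_i$ vertices (nothing further when $k_i=0$). For $2\le p\le q$, $B(p,q)=C_4(1^{p-2}0,1^{q-2}0,1^00,1^00)$, i.e. the 4-cycle with $p-2$ pendant vertices at $v_1$ and $q-2$ pendant vertices at $v_2$.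 *)

theory Defs
  imports Main "HOL-Combinatorics.Permutations"
begin

text \<open>Simple graphs on the vertex set {0..<n}, given by an edge relation.\<close>

definition simple_graph :: "nat \<Rightarrow> (nat \<Rightarrow> nat \<Rightarrow> bool) \<Rightarrow> bool" where
  "simple_graph n E \<longleftrightarrow> (\<forall>i j. E i j \<longrightarrow> i < n \<and> j < n) \<and>
     (\<forall>i j. E i j \<longleftrightarrow> E j i) \<and> (\<forall>i. \<not> E i i)"

definition num_edges :: "nat \<Rightarrow> (nat \<Rightarrow> nat \<Rightarrow> bool) \<Rightarrow> nat" where
  "num_edges n E = card {(i, j). i < j \<and> j < n \<and> E i j}"

definition connected_graph :: "nat \<Rightarrow> (nat \<Rightarrow> nat \<Rightarrow> bool) \<Rightarrow> bool" where
  "connected_graph n E \<longleftrightarrow> (\<forall>u<n. \<forall>v<n. (u, v) \<in> {(i, j). E i j}\<^sup>*)"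

definition unicyclic :: "nat \<Rightarrow> (nat \<Rightarrow> nat \<Rightarrow> bool) \<Rightarrow> bool" where
  "unicyclic n E \<longleftrightarrow> connected_graph n E \<and> num_edges n E = n"

definition bipartite :: "nat \<Rightarrow> (nat \<Rightarrow> nat \<Rightarrow> bool) \<Rightarrow> bool" where
  "bipartite n E \<longleftrightarrow> (\<exists>c :: nat \<Rightarrow> bool. \<forall>i<n. \<forall>j<n. E i j \<longrightarrow> c i \<noteq> c j)"

text \<open>The class U_n: bipartite unicyclic (simple) graphs on n vertices.\<close>
definition bip_unicyclic :: "nat \<Rightarrow> (nat \<Rightarrow> nat \<Rightarrow> bool) \<Rightarrow> bool" where
  "bip_unicyclic n E \<longleftrightarrow> simple_graph n E \<and> unicyclic n E \<and> bipartite n E"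

definition graph_iso :: "nat \<Rightarrow> (nat \<Rightarrow> nat \<Rightarrow> bool) \<Rightarrow> (nat \<Rightarrow> nat \<Rightarrow> bool) \<Rightarrow> bool" where
  "graph_iso n E F \<longleftrightarrow> (\<exists>\<sigma>. bij_betw \<sigma> {..<n} {..<n} \<and>
     (\<forall>i<n. \<forall>j<n. E i j \<longleftrightarrow> F (\<sigma> i) (\<sigma> j)))"

definition degree :: "nat \<Rightarrow> (nat \<Rightarrow> nat \<Rightarrow> bool) \<Rightarrow> nat \<Rightarrow> nat" where
  "degree n E i = card {j. j < n \<and> E i j}"

text \<open>Laplacian matrix L = D - A (entries indexed by {0..<n}).\<close>
definition laplacian :: "nat \<Rightarrow> (nat \<Rightarrow> nat \<Rightarrow> bool) \<Rightarrow> nat \<Rightarrow> nat \<Rightarrow> int" where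
  "laplacian n E i j = (if i = j then int (degree n E i) else if E i j then -1 else 0)"

definition per :: "nat \<Rightarrow> (nat \<Rightarrow> nat \<Rightarrow> int) \<Rightarrow> int" where
  "per n X = (\<Sum>\<sigma> \<in> {\<sigma>. \<sigma> permutes {..<n}}. \<Prod>t<n. X t (\<sigma> t))"

definition lap_per :: "nat \<Rightarrow> (nat \<Rightarrow> nat \<Rightarrow> bool) \<Rightarrow> int" where
  "lap_per n E = per n (laplacian n E)"

text \<open>C_4(1^a 0, 1^b 0, 1^c 0, 1^d 0): the 4-cycle 0-1-2-3-0 with a, b, c, d pendant
  vertices attached at 0, 1, 2, 3 respectively (all star parameters k_i = 0).
  Vertex set {0..<4+a+b+c+d}; pendant vertices are numbered from 4 on.\<close>
definition pend_owner :: "nat \<Rightarrow> nat \<Rightarrow> nat \<Rightarrow> nat \<Rightarrow> nat" where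
  "pend_owner a b c v = (if v < 4 + a then 0 else if v < 4 + a + b then 1
                         else if v < 4 + a + b + c then 2 else 3)"

definition C4_pend :: "nat \<Rightarrow> nat \<Rightarrow> nat \<Rightarrow> nat \<Rightarrow> nat \<Rightarrow> nat \<Rightarrow> bool" where
  "C4_pend a b c d u v \<longleftrightarrow> u < 4 + a + b + c + d \<and> v < 4 + a + b + c + d \<and> u \<noteq> v \<and>
     ((u < 4 \<and> v < 4 \<and> (v = (u + 1) mod 4 \<or> u = (v + 1) mod 4)) \<or>
      (4 \<le> u \<and> v = pend_owner a b c u) \<or> (4 \<le> v \<and> u = pend_owner a b c v))"

text \<open>B(p,q) = C_4(1^{p-2}0, 1^{q-2}0, 1^0 0, 1^0 0), for 2 \<le> p \<le> q.\<close>
definition Bgraph :: "nat \<Rightarrow> nat \<Rightarrow> nat \<Rightarrow> nat \<Rightarrow> bool" where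
  "Bgraph p q = C4_pend (p - 2) (q - 2) 0 0"

end

(* All terms of the permanent of L(G) for bipartite G are nonnegative, so L(G) may be replaced by the
   signless Laplacian. For a leaf w at x, expanding along w gives
     per L(G) = per L(G - w) + 2 per L(G - w)_x,
   where the index x means that row and column x are deleted. Hence a graph with a large permanent all
   of whose deleted minors are at least 22 stays above 44n - 160 when leaves are attached. Stripping
   leaves leads to a graph with all degrees 2. If it has at least five vertices, the identity and the
   transpositions along edges already give a large permanent; attaching a leaf to a pendant vertex of a
   4-cycle with pendants does so too. What remains are the 4-cycles with p_i pendants at vertex i, where
   eliminating the pendants gives the permanent of the 4-cycle with diagonal entries 2 + 2 p_i, and the
   cases are compared numerically. *)
theory Submission
  imports Defs
begin

section \<open>Permanents on finite index sets\<close>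

text \<open>The constant 22 is half of 44: a leaf raises the permanent by twice a deleted minor, so
  minors of at least 22 keep pace with the slope of \<open>44 n - 160\<close>. All minors must be
  controlled, since a later leaf may be attached anywhere. The obstacle is the 4-cycle: its minors
  are only 12, and 2 * 12 is just the slope of \<open>24 n - 60\<close>. So 4-cycles with pendants
  escape this induction and need an exact formula; but as soon as a leaf sits on a pendant vertex,
  all minors are at least 24. The deleted minors keep the degrees of the full graph, so they are not
  permanents of Laplacians. This is why permanents are studied with a free diagonal: removing a leaf
  then amounts to changing one diagonal entry.\<close>

definition per_on :: "'a set \<Rightarrow> ('a \<Rightarrow> 'a \<Rightarrow> int) \<Rightarrow> int" where
  "per_on V X = (\<Sum>\<sigma> \<in> {\<sigma>. \<sigma> permutes V}. \<Prod>t\<in>V. X t (\<sigma> t))"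

lemma per_eq_per_on: "per n X = per_on {..<n} X"
  by (simp add: per_def per_on_def)

lemma per_on_cong:
  assumes "\<And>i j. i \<in> V \<Longrightarrow> j \<in> V \<Longrightarrow> X i j = Y i j"
  shows "per_on V X = per_on V Y"
  unfolding per_on_def
  by (intro sum.cong prod.cong refl assms) (auto simp: permutes_in_image)

text \<open>Expansion along row \<open>w\<close>: every permutation of \<open>insert w U\<close> is
  uniquely \<open>transpose w b\<close> after some \<open>q\<close>, where \<open>b\<close> is the
  image of \<open>w\<close>. The inner sum is a permanent over \<open>U\<close> in which column
  \<open>b\<close> is replaced by column \<open>w\<close>.\<close>

lemma per_on_insert:
  assumes "finite U" "w \<notin> U"
  shows "per_on (insert w U) X =
    (\<Sum>b\<in>insert w U. X w b * (\<Sum>q | q permutes U. \<Prod>t\<in>U. X t (transpose w b (q t))))"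
proof -
  have "(\<Prod>t\<in>insert w U. X t ((transpose w b \<circ> q) t)) =
      X w b * (\<Prod>t\<in>U. X t (transpose w b (q t)))" if "q permutes U" for b q
    using assms that by (simp add: permutes_not_in)
  then show ?thesis
    unfolding per_on_def
    by (subst sum_over_permutations_insert[OF assms]) (simp add: sum_distrib_left)
qed

lemma per_on_isolated:
  assumes "finite U" "w \<notin> U" "\<And>j. j \<in> U \<Longrightarrow> X w j = 0"
  shows "per_on (insert w U) X = X w w * per_on U X"
  using assms by (simp add: per_on_insert) (simp add: per_on_def)

lemma permutes_fixing: "{q. q permutes U \<and> q x = x} = {q. q permutes (U - {x})}"
proof -
  have "q permutes (U - {x})" if "q permutes U" "q x = x" for q
    using that by (auto intro: permutes_superset)
  moreover have "q permutes U" "q x = x" if "q permutes (U - {x})" for q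
    using that by (auto intro: permutes_subset simp: permutes_not_in)
  ultimately show ?thesis by blast
qed

text \<open>Only the permutations fixing \<open>x\<close> see the changed entry, so the permanent is
  affine in it, with the complementary principal minor as slope.\<close>

lemma per_on_update_diag:
  assumes "finite V" "x \<in> V" "X' = X(x := (X x)(x := X x x + k))"
  shows "per_on V X' = per_on V X + k * per_on (V - {x}) X"
proof -
  have upd: "(\<Prod>t\<in>V. X' t (q t)) =
      (\<Prod>t\<in>V. X t (q t)) + (if q x = x then k * (\<Prod>t\<in>V - {x}. X t (q t)) else 0)" for q
  proof -
    have "(\<Prod>t\<in>V. X' t (q t)) = X' x (q x) * (\<Prod>t\<in>V - {x}. X t (q t))"
      using assms by (simp add: prod.remove[of V x])
    moreover have "(\<Prod>t\<in>V. X t (q t)) = X x (q x) * (\<Prod>t\<in>V - {x}. X t (q t))"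
      using assms by (simp add: prod.remove[of V x])
    ultimately show ?thesis
      using assms(3) by (auto simp: distrib_right)
  qed
  have "(\<Sum>q | q permutes V. if q x = x then k * (\<Prod>t\<in>V - {x}. X t (q t)) else 0) =
      (\<Sum>q | q permutes V \<and> q x = x. k * (\<Prod>t\<in>V - {x}. X t (q t)))"
    by (subst sum.inter_filter[symmetric]) (auto simp: finite_permutations assms(1))
  then show ?thesis
    unfolding per_on_def upd by (simp add: sum.distrib permutes_fixing sum_distrib_left)
qed

text \<open>Row \<open>w\<close> lets \<open>w\<close> go only to itself or to \<open>x\<close>; in
  the latter case column \<open>w\<close> forces \<open>x\<close> back to \<open>w\<close>. So
  \<open>w\<close> is either a fixed point or in a 2-cycle with \<open>x\<close>.\<close>

lemma per_on_leaf:
  assumes "finite U" "w \<notin> U" "x \<in> U"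
    and row: "\<And>j. j \<in> U - {x} \<Longrightarrow> X w j = 0"
    and col: "\<And>i. i \<in> U - {x} \<Longrightarrow> X i w = 0"
  shows "per_on (insert w U) X = X w w * per_on U X + X w x * X x w * per_on (U - {x}) X"
proof -
  have swapped: "(\<Prod>t\<in>U. X t (transpose w x (q t))) =
      (if q x = x then X x w * (\<Prod>t\<in>U - {x}. X t (q t)) else 0)" if q: "q permutes U" for q
  proof (cases "q x = x")
    case True
    have "q t \<noteq> w \<and> q t \<noteq> x" if "t \<in> U - {x}" for t
      using that q True assms(2) permutes_in_image[OF q] permutes_inj[OF q]
      by (metis DiffE injD singletonI)
    then have "(\<Prod>t\<in>U - {x}. X t (transpose w x (q t))) = (\<Prod>t\<in>U - {x}. X t (q t))"
      by (intro prod.cong) auto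
    then show ?thesis
      using assms True by (simp add: prod.remove[of U x])
  next
    case False
    obtain t where t: "t \<in> U" "q t = x"
      using permutes_image[OF q] assms(3) by (metis imageE)
    moreover from this have "t \<noteq> x"
      using False by auto
    ultimately have "X t (transpose w x (q t)) = 0"
      using col by simp
    then have "(\<Prod>t\<in>U. X t (transpose w x (q t))) = 0"
      using t(1) assms(1) by (intro prod_zero) blast+
    then show ?thesis
      using False by simp
  qed
  have "(\<Sum>q | q permutes U. \<Prod>t\<in>U. X t (transpose w x (q t))) =
      (\<Sum>q | q permutes U. if q x = x then X x w * (\<Prod>t\<in>U - {x}. X t (q t)) else 0)"
    by (intro sum.cong) (simp_all add: swapped)
  also have "\<dots> = (\<Sum>q | q permutes U \<and> q x = x. X x w * (\<Prod>t\<in>U - {x}. X t (q t)))"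
    by (subst sum.inter_filter[symmetric]) (auto simp: finite_permutations assms(1))
  also have "\<dots> = X x w * per_on (U - {x}) X"
    by (simp add: permutes_fixing per_on_def sum_distrib_left)
  finally have b_x: "(\<Sum>q | q permutes U. \<Prod>t\<in>U. X t (transpose w x (q t))) =
    X x w * per_on (U - {x}) X" .
  have "per_on (insert w U) X = X w w * per_on U X +
    (\<Sum>b\<in>U. X w b * (\<Sum>q | q permutes U. \<Prod>t\<in>U. X t (transpose w b (q t))))"
    using assms by (simp add: per_on_insert) (simp add: per_on_def)
  also have "(\<Sum>b\<in>U. X w b * (\<Sum>q | q permutes U. \<Prod>t\<in>U. X t (transpose w b (q t)))) =
      X w x * (\<Sum>q | q permutes U. \<Prod>t\<in>U. X t (transpose w x (q t)))"
    using assms by (subst sum.remove[of U x]) auto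
  finally show ?thesis by (simp add: b_x)
qed

lemma per_on_reindex:
  assumes "bij_betw \<phi> V W" "finite V"
  shows "per_on W Y = per_on V (\<lambda>i j. Y (\<phi> i) (\<phi> j))"
proof -
  define \<psi> where "\<psi> = inv_into V \<phi>"
  have \<psi>: "bij_betw \<psi> W V" and inv1: "\<And>v. v \<in> V \<Longrightarrow> \<psi> (\<phi> v) = v" and inv2: "\<And>w. w \<in> W \<Longrightarrow> \<phi> (\<psi> w) = w"
    using assms by (auto simp: \<psi>_def bij_betw_inv_into bij_betw_inv_into_left bij_betw_inv_into_right)
  have \<phi>_in: "\<And>v. v \<in> V \<Longrightarrow> \<phi> v \<in> W" and \<psi>_in: "\<And>w. w \<in> W \<Longrightarrow> \<psi> w \<in> V"
    using assms(1) \<psi> by (auto dest: bij_betwE)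
  define fwd where "fwd = (\<lambda>\<sigma> v. if v \<in> V then \<psi> (\<sigma> (\<phi> v)) else v)"
  define bwd where "bwd = (\<lambda>\<tau> w. if w \<in> W then \<phi> (\<tau> (\<psi> w)) else w)"
  have fwd: "fwd \<sigma> permutes V" if s: "\<sigma> permutes W" for \<sigma>
  proof (rule bij_imp_permutes)
    have "bij_betw (\<psi> \<circ> (\<sigma> \<circ> \<phi>)) V V"
      using assms(1) \<psi> permutes_imp_bij[OF s] by (blast intro: bij_betw_trans)
    then show "bij_betw (fwd \<sigma>) V V"
      by (subst bij_betw_cong[where g = "\<psi> \<circ> (\<sigma> \<circ> \<phi>)"]) (auto simp: fwd_def)
  qed (auto simp: fwd_def)
  have bwd: "bwd \<tau> permutes W" if s: "\<tau> permutes V" for \<tau>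
  proof (rule bij_imp_permutes)
    have "bij_betw (\<phi> \<circ> (\<tau> \<circ> \<psi>)) W W"
      using assms(1) \<psi> permutes_imp_bij[OF s] by (blast intro: bij_betw_trans)
    then show "bij_betw (bwd \<tau>) W W"
      by (subst bij_betw_cong[where g = "\<phi> \<circ> (\<tau> \<circ> \<psi>)"]) (auto simp: bwd_def)
  qed (auto simp: bwd_def)
  show ?thesis
    unfolding per_on_def
  proof (rule sum.reindex_bij_witness[where i = bwd and j = fwd])
    fix \<sigma> assume "\<sigma> \<in> {\<sigma>. \<sigma> permutes W}"
    then have s: "\<sigma> permutes W" by simp
    note s_in = permutes_in_image[OF s]
    show "bwd (fwd \<sigma>) = \<sigma>"
      using s_in permutes_not_in[OF s] inv2 \<psi>_in by (auto simp: bwd_def fwd_def fun_eq_iff)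
    show "fwd \<sigma> \<in> {\<sigma>. \<sigma> permutes V}" using fwd s by simp
    have "(\<Prod>t\<in>W. Y t (\<sigma> t)) = (\<Prod>t\<in>V. Y (\<phi> t) (\<sigma> (\<phi> t)))"
      by (rule prod.reindex_bij_betw[OF assms(1), symmetric])
    also have "\<dots> = (\<Prod>t\<in>V. Y (\<phi> t) (\<phi> (fwd \<sigma> t)))"
      using s_in inv2 \<phi>_in by (intro prod.cong) (auto simp: fwd_def)
    finally show "(\<Prod>t\<in>V. Y (\<phi> t) (\<phi> (fwd \<sigma> t))) = (\<Prod>t\<in>W. Y t (\<sigma> t))" ..
  next
    fix \<tau> assume "\<tau> \<in> {\<sigma>. \<sigma> permutes V}"
    then have s: "\<tau> permutes V" by simp
    show "fwd (bwd \<tau>) = \<tau>"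
      using permutes_in_image[OF s] permutes_not_in[OF s] inv1 \<phi>_in
      by (auto simp: bwd_def fwd_def fun_eq_iff)
    show "bwd \<tau> \<in> {\<sigma>. \<sigma> permutes W}" using bwd s by simp
  qed
qed

section \<open>Diagonal weights on a fixed graph\<close>

text \<open>The diagonal is a parameter because eliminating leaves and passing to minors change only
  the diagonal relative to the degrees.\<close>

definition wmat :: "('a \<Rightarrow> 'a \<Rightarrow> bool) \<Rightarrow> ('a \<Rightarrow> int) \<Rightarrow> 'a \<Rightarrow> 'a \<Rightarrow> int" where
  "wmat E y i j = (if i = j then y i else if E i j then 1 else 0)"

definition wper :: "('a \<Rightarrow> 'a \<Rightarrow> bool) \<Rightarrow> 'a set \<Rightarrow> ('a \<Rightarrow> int) \<Rightarrow> int" where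
  "wper E V y = per_on V (wmat E y)"

text \<open>In the bipartite case, conjugating by the diagonal matrix of colour signs makes every
  off-diagonal entry nonnegative and leaves the permanent unchanged.\<close>

lemma per_laplacian_eq_wper:
  assumes "simple_graph n E" "bipartite n E"
  shows "lap_per n E = wper E {..<n} (\<lambda>v. int (degree n E v))"
proof -
  obtain c where c: "\<And>i j. i < n \<Longrightarrow> j < n \<Longrightarrow> E i j \<Longrightarrow> c i \<noteq> (c j :: bool)"
    using assms(2) by (auto simp: bipartite_def)
  define s :: "nat \<Rightarrow> int" where "s i = (if c i then 1 else -1)" for i
  define M where "M = wmat E (\<lambda>v. int (degree n E v))"
  have entry: "laplacian n E i j = s i * s j * M i j" if "i < n" "j < n" for i j
    using c[OF that] by (auto simp: laplacian_def M_def wmat_def s_def)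
  have "(\<Prod>t<n. laplacian n E t (\<sigma> t)) = (\<Prod>t<n. M t (\<sigma> t))"
    if p: "\<sigma> permutes {..<n}" for \<sigma>
  proof -
    have "(\<Prod>t<n. laplacian n E t (\<sigma> t)) = (\<Prod>t<n. s t * s (\<sigma> t) * M t (\<sigma> t))"
      using permutes_in_image[OF p] by (intro prod.cong) (auto simp: entry)
    also have "\<dots> = (\<Prod>t<n. s t) * (\<Prod>t<n. s (\<sigma> t)) * (\<Prod>t<n. M t (\<sigma> t))"
      by (simp add: prod.distrib)
    also have "(\<Prod>t<n. s (\<sigma> t)) = (\<Prod>t<n. s t)"
      using prod.permute[OF p, of s] by (simp add: o_def)
    also have "(\<Prod>t<n. s t) * (\<Prod>t<n. s t) = (1::int)"
      unfolding prod.distrib[symmetric] by (rule prod.neutral) (simp add: s_def)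
    finally show ?thesis by simp
  qed
  then show ?thesis
    by (simp add: lap_per_def per_def wper_def per_on_def M_def)
qed

lemma wper_nonneg:
  assumes "\<And>v. v \<in> V \<Longrightarrow> 0 \<le> y v"
  shows "0 \<le> wper E V y"
  unfolding wper_def per_on_def
  by (intro sum_nonneg prod_nonneg) (auto simp: wmat_def assms)

lemma wper_mono:
  assumes "\<And>v. v \<in> V \<Longrightarrow> 0 \<le> y v" "\<And>v. v \<in> V \<Longrightarrow> y v \<le> z v"
  shows "wper E V y \<le> wper E V z"
  unfolding wper_def per_on_def
  by (intro sum_mono prod_mono) (auto simp: wmat_def assms)

lemma wper_cong: "(\<And>v. v \<in> V \<Longrightarrow> y v = z v) \<Longrightarrow> wper E V y = wper E V z"
  unfolding wper_def by (rule per_on_cong) (auto simp: wmat_def)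

lemma wper_add:
  assumes "finite V" "x \<in> V"
  shows "wper E V (y(x := y x + k)) = wper E V y + k * wper E (V - {x}) y"
  unfolding wper_def
  by (subst per_on_update_diag[OF assms, where X = "wmat E y" and k = k])
     (auto simp: wmat_def fun_eq_iff intro: per_on_cong)

lemma wper_isolated:
  assumes "finite V" "w \<in> V" "\<And>j. j \<in> V - {w} \<Longrightarrow> \<not> E w j"
  shows "wper E V y = y w * wper E (V - {w}) y"
proof -
  have "wmat E y w j = 0" if "j \<in> V - {w}" for j
    using assms(3)[OF that] that by (auto simp: wmat_def)
  then have "per_on (insert w (V - {w})) (wmat E y) = wmat E y w w * per_on (V - {w}) (wmat E y)"
    using assms(1) by (intro per_on_isolated) auto
  then show ?thesis
    using assms(2) by (simp add: wper_def wmat_def insert_absorb)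
qed

text \<open>For a leaf of weight 1, the two terms of \<open>per_on_leaf\<close> are a permanent and
  its minor at \<open>x\<close>; by \<open>wper_add\<close> their sum is the permanent with one more
  unit of weight at \<open>x\<close>.\<close>

lemma wper_leaf:
  assumes "finite V" "w \<in> V" "x \<in> V" "w \<noteq> x" "y w = 1" "symp E" "E w x"
    and "\<And>j. j \<in> V - {w, x} \<Longrightarrow> \<not> E w j"
  shows "wper E V y = wper E (V - {w}) (y(x := y x + 1))"
proof -
  have "E x w" "\<And>j. j \<in> V - {w, x} \<Longrightarrow> \<not> E j w"
    using assms(6-8) by (auto dest: sympD)
  then have zero: "wmat E y w j = 0" "wmat E y j w = 0" if "j \<in> V - {w} - {x}" for j
    using assms(8)[of j] that by (auto simp: wmat_def)
  have one: "wmat E y w w = 1" "wmat E y w x = 1" "wmat E y x w = 1"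
    using assms(4,5,7) \<open>E x w\<close> by (auto simp: wmat_def)
  have "per_on (insert w (V - {w})) (wmat E y) = wmat E y w w * per_on (V - {w}) (wmat E y) +
      wmat E y w x * wmat E y x w * per_on (V - {w} - {x}) (wmat E y)"
    using assms(1,3,4) zero by (intro per_on_leaf) auto
  then have "wper E V y = wper E (V - {w}) y + wper E (V - {w} - {x}) y"
    using assms(2) by (simp add: one wper_def insert_absorb)
  also have "\<dots> = wper E (V - {w}) (y(x := y x + 1))"
    using assms by (simp add: wper_add)
  finally show ?thesis .
qed

section \<open>Lower bound from the identity and edge transpositions\<close>

lemma inj_transpose_less:
  "inj_on (\<lambda>(i, j). transpose i j) {(i, j). i < (j::'a::linorder)}"
proof (rule inj_onI, clarsimp)
  fix i j k l :: 'a
  assume h: "i < j" "k < l" "transpose i j = transpose k l"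
  have "transpose k l i = j" "transpose k l j = i"
    by (simp_all flip: h(3))
  then show "i = k \<and> j = l" using h(1,2)
    by (auto simp: transpose_def split: if_splits)
qed

text \<open>Only the identity and the transpositions along edges are kept.\<close>

lemma wper_const2_lower_bound:
  fixes V :: "'a::linorder set"
  assumes "finite V" "symp E"
    and F: "F \<subseteq> {(i, j). i \<in> V \<and> j \<in> V \<and> i < j \<and> E i j}"
  shows "2 ^ card V + int (card F) * 2 ^ (card V - 2) \<le> wper E V (\<lambda>_. 2)"
proof -
  let ?m = "\<lambda>\<sigma>. \<Prod>t\<in>V. wmat E (\<lambda>_. 2) t (\<sigma> t)"
  define T where "T = (\<lambda>(i, j). transpose i j) ` F"
  have injF: "inj_on (\<lambda>(i, j). transpose i j) F"
    using F by (intro inj_on_subset[OF inj_transpose_less]) auto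
  have finF: "finite F"
    by (rule finite_subset[of _ "V \<times> V"]) (use F assms(1) in auto)
  have Tid: "id \<notin> T"
  proof
    assume "id \<in> T"
    then obtain i j where "(i, j) \<in> F" and eq: "transpose i j = id"
      unfolding T_def by (metis (no_types, lifting) case_prod_conv imageE surj_pair)
    then have ij: "i < j" using F by auto
    from eq have "transpose i j i = i" by simp
    with ij show False by simp
  qed
  \<comment> \<open>Two factors are edge entries 1; the others are diagonal entries 2.\<close>
  have transposition_term: "?m (transpose i j) = 2 ^ (card V - 2)" if "(i, j) \<in> F" for i j
  proof -
    have ij: "i \<in> V" "j \<in> V" "i \<noteq> j" "E i j" "E j i" using F that assms(2) by (auto dest: sympD)
    have "?m (transpose i j) = (\<Prod>t\<in>V - {i} - {j}. wmat E (\<lambda>_. 2) t (transpose i j t))"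
      using ij assms(1) by (simp add: prod.remove[of V i] prod.remove[of "V - {i}" j] wmat_def)
    also have "\<dots> = (\<Prod>t\<in>V - {i} - {j}. 2)"
      by (intro prod.cong) (auto simp: wmat_def)
    also have "\<dots> = 2 ^ (card V - 2)"
      using ij assms(1) by simp
    finally show ?thesis .
  qed
  have "(\<Sum>\<sigma>\<in>T. ?m \<sigma>) = (\<Sum>(i, j)\<in>F. ?m (transpose i j))"
    unfolding T_def by (subst sum.reindex[OF injF]) (simp add: o_def case_prod_unfold)
  also have "\<dots> = (\<Sum>p\<in>F. 2 ^ (card V - 2))"
    by (intro sum.cong) (auto simp: transposition_term)
  also have "\<dots> = int (card F) * 2 ^ (card V - 2)" by simp
  finally have "(\<Sum>\<sigma>\<in>insert id T. ?m \<sigma>) = ?m id + int (card F) * 2 ^ (card V - 2)"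
    using Tid finF by (subst sum.insert) (simp_all add: T_def)
  then have "2 ^ card V + int (card F) * 2 ^ (card V - 2) = (\<Sum>\<sigma>\<in>insert id T. ?m \<sigma>)"
    by (simp add: wmat_def)
  also have "\<dots> \<le> wper E V (\<lambda>_. 2)"
    unfolding wper_def per_on_def
  proof (rule sum_mono2)
    show "insert id T \<subseteq> {\<sigma>. \<sigma> permutes V}"
      using F by (auto simp: T_def intro: permutes_swap_id)
  qed (auto simp: finite_permutations assms(1) wmat_def intro!: prod_nonneg)
  finally show ?thesis .
qed

section \<open>Leaves\<close>

text \<open>The relation stays fixed while the vertex set is an argument of every notion, so
  removing a leaf needs no relabelling. The order on vertices lets an edge be stored as one pair
  \<open>i < j\<close>.\<close>

locale sgraph =
  fixes E :: "'a::linorder \<Rightarrow> 'a \<Rightarrow> bool"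
  assumes symp_E: "symp E" and irreflp_E: "irreflp E"
begin

lemma adj_sym: "E u v \<longleftrightarrow> E v u"
  using symp_E by (auto dest: sympD)

lemma adj_irrefl [simp]: "\<not> E v v"
  using irreflp_E by (auto dest: irreflpD)

definition dg :: "'a set \<Rightarrow> 'a \<Rightarrow> int" where
  "dg V v = int (card {j \<in> V. E v j})"

definition leaf :: "'a set \<Rightarrow> 'a \<Rightarrow> 'a \<Rightarrow> bool" where
  "leaf V w x \<longleftrightarrow> w \<in> V \<and> {j \<in> V. E w j} = {x}"

text \<open>\<open>lper V\<close> and \<open>lper_del V u\<close> are the permanents of the (signless) Laplacian matrix of the
  subgraph induced on \<open>V\<close> and of its principal submatrix without the row and column of \<open>u\<close>,
  where the degrees are still those in \<open>V\<close>.\<close>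

definition lper :: "'a set \<Rightarrow> int" where
  "lper V = wper E V (dg V)"

definition lper_del :: "'a set \<Rightarrow> 'a \<Rightarrow> int" where
  "lper_del V u = wper E (V - {u}) (dg V)"

lemma dg_nonneg [simp]: "0 \<le> dg V v"
  by (simp add: dg_def)

lemma lper_del_nonneg: "0 \<le> lper_del V u"
  unfolding lper_del_def by (rule wper_nonneg) simp

lemma dg_remove:
  assumes "finite V" "w \<in> V"
  shows "dg V v = dg (V - {w}) v + (if E v w then 1 else 0)"
proof -
  have "{j \<in> V. E v j} = (if E v w then insert w {j \<in> V - {w}. E v j} else {j \<in> V - {w}. E v j})"
    using assms by auto
  then show ?thesis
    using assms by (simp add: dg_def)
qed

lemma leafD:
  assumes "leaf V w x"
  shows "w \<in> V" "x \<in> V" "w \<noteq> x" "E w x" "\<And>j. j \<in> V \<Longrightarrow> E w j \<longleftrightarrow> j = x" "dg V w = 1"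
  using assms by (auto simp: leaf_def dg_def)

lemma dg_leaf_remove:
  assumes "finite V" "leaf V w x" "v \<in> V"
  shows "dg V v = dg (V - {w}) v + (if v = x then 1 else 0)"
  using dg_remove[OF assms(1) leafD(1)[OF assms(2)], of v] leafD(5)[OF assms(2,3)] adj_sym[of v w]
  by simp

text \<open>The leaf counts twice at \<open>x\<close>: one unit comes from eliminating it by
  \<open>wper_leaf\<close>, one from the degree that \<open>x\<close> has in \<open>V\<close> but no
  longer in \<open>V - {w}\<close>.\<close>

lemma wper_remove_leaf:
  assumes "finite V" "leaf V w x" "u \<noteq> w" "u \<noteq> x"
  shows "wper E (V - {u}) (dg V) =
    wper E (V - {w} - {u}) ((dg (V - {w}))(x := dg (V - {w}) x + 2))"
proof -
  note L = leafD[OF assms(2)]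
  have "wper E (V - {u}) (dg V) = wper E (V - {u} - {w}) ((dg V)(x := dg V x + 1))"
    using assms L by (intro wper_leaf symp_E) auto
  also have "\<dots> = wper E (V - {u} - {w}) ((dg (V - {w}))(x := dg (V - {w}) x + 2))"
    using dg_leaf_remove[OF assms(1,2)] L by (intro wper_cong) auto
  also have "V - {u} - {w} = V - {w} - {u}" by auto
  finally show ?thesis .
qed

lemma lper_leaf:
  assumes "finite V" "leaf V w x"
  shows "lper V = lper (V - {w}) + 2 * lper_del (V - {w}) x"
proof -
  note L = leafD[OF assms(2)]
  have "lper V = wper E (V - {w}) ((dg V)(x := dg V x + 1))"
    unfolding lper_def using assms L by (intro wper_leaf symp_E) auto
  also have "\<dots> = wper E (V - {w}) ((dg (V - {w}))(x := dg (V - {w}) x + 2))"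
    using dg_leaf_remove[OF assms] L by (intro wper_cong) auto
  also have "\<dots> = lper (V - {w}) + 2 * lper_del (V - {w}) x"
    using assms L by (simp add: lper_def lper_del_def wper_add)
  finally show ?thesis .
qed

text \<open>If \<open>u = x\<close>, deleting \<open>u\<close> isolates \<open>w\<close> with weight
  1, and both sides agree. Otherwise eliminating \<open>w\<close> only adds weight at
  \<open>x\<close>, and the permanent is monotone in nonnegative weights.\<close>

lemma lper_del_leaf_mono:
  assumes "finite V" "leaf V w x" "u \<in> V - {w}"
  shows "lper_del (V - {w}) u \<le> lper_del V u"
proof (cases "u = x")
  case True
  note L = leafD[OF assms(2)]
  have "lper_del V u = dg V w * wper E (V - {u} - {w}) (dg V)"
    unfolding lper_del_def using assms L True by (intro wper_isolated) auto
  also have "\<dots> = wper E (V - {u} - {w}) (dg V)"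
    using L by simp
  also have "\<dots> = wper E (V - {u} - {w}) (dg (V - {w}))"
    by (rule wper_cong) (use dg_leaf_remove[OF assms(1,2)] True in auto)
  also have "V - {u} - {w} = V - {w} - {u}" by auto
  finally show ?thesis by (simp add: lper_del_def)
next
  case False
  then have "lper_del V u = wper E (V - {w} - {u}) ((dg (V - {w}))(x := dg (V - {w}) x + 2))"
    unfolding lper_del_def using assms by (intro wper_remove_leaf) auto
  also have "\<dots> \<ge> lper_del (V - {w}) u"
    unfolding lper_del_def by (rule wper_mono) auto
  finally show ?thesis .
qed

text \<open>The minor keeps the edges to \<open>w\<close> in its diagonal, so it dominates. This
  bounds the minor at a newly attached vertex, which \<open>lper_del_leaf_mono\<close> does not
  reach.\<close>

lemma lper_le_lper_del_leaf:
  assumes "finite V" "w \<in> V"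
  shows "lper (V - {w}) \<le> lper_del V w"
  unfolding lper_def lper_del_def
  by (rule wper_mono) (use dg_remove[OF assms] in auto)

section \<open>A core with pendant vertices\<close>

definition pendants :: "'a set \<Rightarrow> 'a set \<Rightarrow> bool" where
  "pendants C P \<longleftrightarrow> finite C \<and> finite P \<and> C \<inter> P = {} \<and>
    (\<forall>w\<in>P. \<exists>x\<in>C. leaf (C \<union> P) w x)"

lemma pendants_remove:
  assumes "pendants C (insert w P)" "w \<notin> P"
  shows "pendants C P" "\<exists>x\<in>C. leaf (insert w (C \<union> P)) w x" "insert w (C \<union> P) - {w} = C \<union> P"
proof -
  have *: "\<exists>x\<in>C. leaf (insert w (C \<union> P)) v x" if "v \<in> insert w P" for v
    using assms(1) that by (auto simp: pendants_def)
  then show "\<exists>x\<in>C. leaf (insert w (C \<union> P)) w x" by simp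
  have "\<exists>x\<in>C. leaf (C \<union> P) v x" if v: "v \<in> P" for v
  proof -
    obtain x where "x \<in> C" "leaf (insert w (C \<union> P)) v x" using *[of v] v by auto
    then have "leaf (C \<union> P) v x" using v by (auto simp: leaf_def)
    with \<open>x \<in> C\<close> show ?thesis by blast
  qed
  then show "pendants C P" using assms(1) by (auto simp: pendants_def)
  show "insert w (C \<union> P) - {w} = C \<union> P" using assms by (auto simp: pendants_def)
qed

lemma lper_del_pendants:
  assumes "finite P" "pendants C P" "u \<in> C"
  shows "lper_del C u \<le> lper_del (C \<union> P) u"
  using assms
proof (induction P)
  case (insert w P)
  note R = pendants_remove[OF insert.prems(1) insert.hyps(2)]
  obtain x where x: "leaf (insert w (C \<union> P)) w x" using R(2) by auto
  have "w \<notin> C" using insert.prems by (auto simp: pendants_def)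
  then have "lper_del (insert w (C \<union> P) - {w}) u \<le> lper_del (insert w (C \<union> P)) u"
    using x insert.prems insert.hyps by (intro lper_del_leaf_mono) (auto simp: pendants_def)
  then show ?case using insert.IH[OF R(1)] insert.prems R(3) by simp
qed simp

lemma wper_pendants:
  assumes "finite P" "pendants C P" "\<And>w. w \<in> P \<Longrightarrow> y w = 1"
  shows "wper E (C \<union> P) y = wper E C (\<lambda>x. y x + int (card {w \<in> P. E w x}))"
  using assms
proof (induction P arbitrary: y)
  case (insert w P)
  note R = pendants_remove[OF insert.prems(1) insert.hyps(2)]
  obtain x where x: "x \<in> C" "leaf (insert w (C \<union> P)) w x" using R(2) by auto
  note L = leafD[OF x(2)]
  have w: "w \<notin> C" and fin: "finite C" using insert.prems by (auto simp: pendants_def)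
  have "wper E (insert w (C \<union> P)) y = wper E (insert w (C \<union> P) - {w}) (y(x := y x + 1))"
    using L fin insert.hyps insert.prems by (intro wper_leaf symp_E) auto
  also have "\<dots> = wper E C (\<lambda>z. (y(x := y x + 1)) z + int (card {v \<in> P. E v z}))"
    unfolding R(3) using insert.prems x w
    by (intro insert.IH R(1)) (auto simp: pendants_def)
  also have "\<dots> = wper E C (\<lambda>z. y z + int (card {v \<in> insert w P. E v z}))"
  proof (rule wper_cong)
    fix z assume "z \<in> C"
    then have "E w z \<longleftrightarrow> z = x" using L(5)[of z] by auto
    moreover have "{v \<in> insert w P. E v z} =
        (if E w z then insert w {v \<in> P. E v z} else {v \<in> P. E v z})"
      by auto
    ultimately show "(y(x := y x + 1)) z + int (card {v \<in> P. E v z}) =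
        y z + int (card {v \<in> insert w P. E v z})"
      using insert.hyps by auto
  qed
  finally show ?case by simp
qed simp

text \<open>Each pendant contributes once to the degree of its neighbour and once more when it is
  eliminated, hence the factor 2.\<close>

lemma lper_pendants:
  assumes "pendants C P"
  shows "lper (C \<union> P) = wper E C (\<lambda>x. dg C x + 2 * int (card {w \<in> P. E w x}))"
proof -
  have fin: "finite C" "finite P" "C \<inter> P = {}" using assms by (auto simp: pendants_def)
  have dg1: "dg (C \<union> P) w = 1" if "w \<in> P" for w
    using assms that leafD(6) by (auto simp: pendants_def)
  have "dg (C \<union> P) x = dg C x + int (card {w \<in> P. E w x})" for x
  proof -
    have "{j \<in> C \<union> P. E x j} = {j \<in> C. E x j} \<union> {w \<in> P. E w x}"
      using adj_sym by auto
    moreover have "card ({j \<in> C. E x j} \<union> {w \<in> P. E w x}) = card {j \<in> C. E x j} + card {w \<in> P. E w x}"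
      using fin by (intro card_Un_disjoint) auto
    ultimately show ?thesis by (simp add: dg_def)
  qed
  then show ?thesis
    unfolding lper_def using wper_pendants[OF fin(2) assms, of "dg (C \<union> P)"] dg1
    by (simp add: add.assoc)
qed

section \<open>Four-cycles\<close>

definition C4 :: "'a \<Rightarrow> 'a \<Rightarrow> 'a \<Rightarrow> 'a \<Rightarrow> bool" where
  "C4 c0 c1 c2 c3 \<longleftrightarrow> distinct [c0, c1, c2, c3] \<and>
    E c0 c1 \<and> E c1 c2 \<and> E c2 c3 \<and> E c3 c0 \<and> \<not> E c0 c2 \<and> \<not> E c1 c3"

lemma C4_rotate: "C4 c0 c1 c2 c3 \<Longrightarrow> C4 c1 c2 c3 c0"
  using adj_sym by (auto simp: C4_def)

lemma C4_reflect: "C4 c0 c1 c2 c3 \<Longrightarrow> C4 c0 c3 c2 c1"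
  using adj_sym by (auto simp: C4_def)

text \<open>The nonzero terms come from the identity, the four transpositions along edges, and, each
  contributing 1, the two perfect matchings and the two orientations of the cycle.\<close>

lemma wper_C4:
  assumes "C4 a b c d"
  shows "wper E {a, b, c, d} y =
    y a * y b * y c * y d + y a * y b + y b * y c + y c * y d + y d * y a + 4"
proof -
  have adj: "E a b" "E b a" "E b c" "E c b" "E c d" "E d c" "E d a" "E a d"
    "\<not> E a c" "\<not> E c a" "\<not> E b d" "\<not> E d b"
    using assms adj_sym by (auto simp: C4_def)
  have dist: "a \<noteq> b" "a \<noteq> c" "a \<noteq> d" "b \<noteq> c" "b \<noteq> d" "c \<noteq> d"
    "b \<noteq> a" "c \<noteq> a" "d \<noteq> a" "c \<noteq> b" "d \<noteq> b" "d \<noteq> c"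
    using assms by (auto simp: C4_def)
  show ?thesis
    unfolding wper_def per_on_def
    by (simp add: sum_over_permutations_insert dist adj wmat_def transpose_def)
qed

lemma dg_C4:
  assumes "C4 a b c d" "x \<in> {a, b, c, d}"
  shows "dg {a, b, c, d} x = 2"
proof -
  have adj: "E a b" "E b a" "E b c" "E c b" "E c d" "E d c" "E d a" "E a d"
    "\<not> E a c" "\<not> E c a" "\<not> E b d" "\<not> E d b"
    using assms adj_sym by (auto simp: C4_def)
  have "{j \<in> {a, b, c, d}. E x j} = (if x = a \<or> x = c then {b, d} else {a, c})"
    using assms(2) adj by auto
  then show ?thesis using assms(1) by (auto simp: dg_def C4_def)
qed

text \<open>The minor is read off as a slope: raising one weight from 2 to 3 raises the permanent of
  the 4-cycle from 36 to 48.\<close>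

lemma lper_del_C4:
  assumes "C4 a b c d" "x \<in> {a, b, c, d}"
  shows "lper_del {a, b, c, d} x = 12"
proof -
  let ?C = "{a, b, c, d}"
  have "wper E ?C ((\<lambda>_. 2)(x := (2::int) + 1)) = wper E ?C (\<lambda>_. 2) + 1 * wper E (?C - {x}) (\<lambda>_. 2)"
    by (rule wper_add) (use assms in auto)
  then have "wper E (?C - {x}) (\<lambda>_. 2) = 12"
    unfolding wper_C4[OF assms(1)] using assms by (auto simp: C4_def)
  then show ?thesis
    unfolding lper_del_def using wper_cong[of "?C - {x}" "dg ?C" "\<lambda>_. 2" E] dg_C4[OF assms(1)] by auto
qed

definition pend_C4 :: "'a set \<Rightarrow> 'a \<Rightarrow> 'a \<Rightarrow> 'a \<Rightarrow> 'a \<Rightarrow> bool" where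
  "pend_C4 V a b c d \<longleftrightarrow> C4 a b c d \<and> {a, b, c, d} \<subseteq> V \<and> pendants {a, b, c, d} (V - {a, b, c, d})"

definition npend :: "'a set \<Rightarrow> 'a \<Rightarrow> 'a \<Rightarrow> 'a \<Rightarrow> 'a \<Rightarrow> 'a \<Rightarrow> nat" where
  "npend V a b c d x = card {w \<in> V - {a, b, c, d}. E w x}"

lemma pend_C4_rotate: "pend_C4 V a b c d \<Longrightarrow> pend_C4 V b c d a"
proof -
  have "{b, c, d, a} = {a, b, c, d}" by auto
  then show "pend_C4 V a b c d \<Longrightarrow> pend_C4 V b c d a"
    using C4_rotate by (simp add: pend_C4_def)
qed

lemma pend_C4_reflect: "pend_C4 V a b c d \<Longrightarrow> pend_C4 V a d c b"
proof -
  have "{a, d, c, b} = {a, b, c, d}" by auto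
  then show "pend_C4 V a b c d \<Longrightarrow> pend_C4 V a d c b"
    using C4_reflect by (simp add: pend_C4_def)
qed

lemma pend_C4_finite: "pend_C4 V a b c d \<Longrightarrow> finite V"
  by (auto simp: pend_C4_def pendants_def)

lemma pend_C4_leaf:
  assumes "pend_C4 V a b c d" "w \<in> V - {a, b, c, d}"
  obtains x where "x \<in> {a, b, c, d}" "leaf V w x"
proof -
  have V: "{a, b, c, d} \<union> (V - {a, b, c, d}) = V" using assms(1) by (auto simp: pend_C4_def)
  have "\<exists>x\<in>{a, b, c, d}. leaf ({a, b, c, d} \<union> (V - {a, b, c, d})) w x"
    using assms unfolding pend_C4_def pendants_def by blast
  then show ?thesis unfolding V using that by blast
qed

text \<open>A pendant has exactly one neighbour, so the four sets of pendants partition the vertices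
  off the cycle.\<close>

lemma card_pend_C4:
  assumes "pend_C4 V a b c d"
  shows "card V = 4 + npend V a b c d a + npend V a b c d b + npend V a b c d c + npend V a b c d d"
proof -
  let ?C = "{a, b, c, d}" and ?S = "\<lambda>x. {w \<in> V - {a, b, c, d}. E w x}"
  have dist: "distinct [a, b, c, d]" using assms by (auto simp: pend_C4_def C4_def)
  have fin: "finite V" using assms by (rule pend_C4_finite)
  have one: "x = y" if w: "w \<in> V - ?C" and xy: "E w x" "E w y" "x \<in> ?C" "y \<in> ?C" for w x y
  proof -
    obtain z where z: "leaf V w z" by (rule pend_C4_leaf[OF assms w])
    have "x \<in> V" "y \<in> V" using xy assms unfolding pend_C4_def by blast+
    then show ?thesis using leafD(5)[OF z] xy by metis
  qed
  have disj: "?S x \<inter> ?S y = {}" if xy: "x \<in> ?C" "y \<in> ?C" "x \<noteq> y" for x y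
  proof (rule equals0I)
    fix w assume "w \<in> ?S x \<inter> ?S y"
    then have "w \<in> V - ?C" "E w x" "E w y" by simp_all
    from xy(3) one[OF this xy(1,2)] show False by contradiction
  qed
  have "V - ?C = (\<Union>x\<in>?C. ?S x)"
  proof (intro equalityI subsetI)
    fix w assume w: "w \<in> V - ?C"
    obtain x where "x \<in> ?C" "leaf V w x" by (rule pend_C4_leaf[OF assms w])
    then have "x \<in> ?C" "w \<in> ?S x" using w leafD(4) by auto
    then show "w \<in> (\<Union>x\<in>?C. ?S x)" by (rule UN_I)
  qed auto
  then have "card (V - ?C) = card (\<Union>x\<in>?C. ?S x)" by (rule arg_cong)
  also have "\<dots> = (\<Sum>x\<in>?C. card (?S x))"
    by (intro card_UN_disjoint ballI impI disj) (use fin in simp_all)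
  also have "\<dots> = card (?S a) + card (?S b) + card (?S c) + card (?S d)"
    using dist by simp
  finally have "card (V - ?C) = card (?S a) + card (?S b) + card (?S c) + card (?S d)" .
  moreover have "card V = card ?C + card (V - ?C)"
    using assms fin unfolding pend_C4_def by (metis card_Diff_subset card_mono finite_subset le_add_diff_inverse)
  ultimately show ?thesis using dist by (simp add: npend_def)
qed

lemma lper_pend_C4:
  assumes "pend_C4 V a b c d"
  defines "y \<equiv> \<lambda>x. 2 + 2 * int (npend V a b c d x)"
  shows "lper V = y a * y b * y c * y d + y a * y b + y b * y c + y c * y d + y d * y a + 4"
proof -
  let ?C = "{a, b, c, d}"
  have C4: "C4 a b c d" and V: "V = ?C \<union> (V - ?C)" and P: "pendants ?C (V - ?C)"
    using assms(1) by (auto simp: pend_C4_def)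
  have "lper V = lper (?C \<union> (V - ?C))" using V by simp
  also have "\<dots> = wper E ?C (\<lambda>x. dg ?C x + 2 * int (card {w \<in> V - ?C. E w x}))"
    by (rule lper_pendants[OF P])
  also have "\<dots> = wper E ?C y"
    by (rule wper_cong) (use dg_C4[OF C4] in \<open>auto simp: y_def npend_def\<close>)
  finally show ?thesis by (simp add: wper_C4[OF C4])
qed

lemma pend_C4_remove:
  assumes "pend_C4 V a b c d" "w \<in> V - {a, b, c, d}"
  shows "pend_C4 (V - {w}) a b c d"
proof -
  have "V - {a, b, c, d} = insert w (V - {w} - {a, b, c, d})" using assms(2) by auto
  then have "pendants {a, b, c, d} (V - {w} - {a, b, c, d})"
    using assms(1) pendants_remove(1)[of "{a, b, c, d}" w "V - {w} - {a, b, c, d}"]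
    by (simp add: pend_C4_def)
  then show ?thesis using assms by (auto simp: pend_C4_def)
qed

lemma lper_pend_C4_ge:
  assumes "pend_C4 V a b c d"
  shows "24 * int (card V) - 60 \<le> lper V" "36 \<le> lper V"
proof -
  define p q r s where pqrs: "p = int (npend V a b c d a)" "q = int (npend V a b c d b)"
    "r = int (npend V a b c d c)" "s = int (npend V a b c d d)"
  have nn: "0 \<le> p" "0 \<le> q" "0 \<le> r" "0 \<le> s" by (simp_all add: pqrs)
  \<comment> \<open>\<open>A\<close> collects the products over adjacent pairs of cycle vertices,
    \<open>B\<close> those over opposite pairs. Naming them leaves a linear problem; the constant
    and linear terms alone equal \<open>24 * card V - 60\<close>.\<close>
  define A B C D where ABCD: "A = (p + r) * (q + s)" "B = p * r + q * s"
    "C = p * q * r + q * r * s + r * s * p + s * p * q" "D = p * q * r * s"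
  have "lper V = 36 + 24 * (p + q + r + s) + 20 * A + 16 * B + 16 * C + 16 * D"
    unfolding lper_pend_C4[OF assms] ABCD pqrs by (simp add: algebra_simps)
  moreover have "int (card V) = 4 + p + q + r + s" using card_pend_C4[OF assms] by (simp add: pqrs)
  moreover have "0 \<le> A" "0 \<le> B" "0 \<le> C" "0 \<le> D"
    using nn by (auto simp: ABCD)
  ultimately have "24 * int (card V) - 60 \<le> lper V \<and> 36 \<le> lper V" using nn by simp
  then show "24 * int (card V) - 60 \<le> lper V" "36 \<le> lper V" by simp_all
qed

text \<open>At a cycle vertex the bare 4-cycle already gives 12. At a pendant, the minor dominates
  the permanent of the graph without it, which is at least 36.\<close>

lemma lper_del_pend_C4_ge:
  assumes "pend_C4 V a b c d" "u \<in> V"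
  shows "12 \<le> lper_del V u"
proof (cases "u \<in> {a, b, c, d}")
  case True
  have V: "V = {a, b, c, d} \<union> (V - {a, b, c, d})" and P: "pendants {a, b, c, d} (V - {a, b, c, d})"
    and "C4 a b c d" using assms by (auto simp: pend_C4_def)
  then have "lper_del {a, b, c, d} u \<le> lper_del ({a, b, c, d} \<union> (V - {a, b, c, d})) u"
    using True by (intro lper_del_pendants) (auto simp: pendants_def)
  then show ?thesis using lper_del_C4[OF \<open>C4 a b c d\<close> True] V by simp
next
  case False
  then have "36 \<le> lper (V - {u})"
    using assms lper_pend_C4_ge(2) pend_C4_remove by blast
  also have "\<dots> \<le> lper_del V u"
    using assms by (intro lper_le_lper_del_leaf pend_C4_finite)
  finally show ?thesis by simp
qed

section \<open>Graphs with large permanent\<close>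

text \<open>The bound on \<open>lper_del\<close> makes this property hereditary under attaching a leaf, which
  raises the permanent by twice that quantity.\<close>

definition heavy :: "'a set \<Rightarrow> bool" where
  "heavy V \<longleftrightarrow> 5 \<le> card V \<and> 44 * int (card V) - 160 < lper V \<and> (\<forall>u\<in>V. 22 \<le> lper_del V u)"

lemma heavy_attach_leaf:
  assumes "finite V" "leaf V w x" "heavy (V - {w})"
  shows "heavy V"
proof -
  note L = leafD[OF assms(2)]
  have card: "card V = Suc (card (V - {w}))" using L assms(1) by (intro card.remove)
  have x: "22 \<le> lper_del (V - {w}) x" using assms(3) L by (auto simp: heavy_def)
  have "44 * int (card V) - 160 < lper V"
    using assms(3) x lper_leaf[OF assms(1,2)] card unfolding heavy_def by linarith
  moreover have "22 \<le> lper_del V u" if "u \<in> V" for u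
  proof (cases "u = w")
    case True
    \<comment> \<open>As \<open>V - {w}\<close> has at least five vertices, its permanent exceeds
      \<open>44 * 5 - 160 = 60\<close>.\<close>
    then show ?thesis
      using lper_le_lper_del_leaf[OF assms(1) L(1)] assms(3) by (simp add: heavy_def)
  next
    case False
    then have "22 \<le> lper_del (V - {w}) u"
      using assms(3) that by (auto simp: heavy_def)
    also have "\<dots> \<le> lper_del V u"
      using False that by (intro lper_del_leaf_mono[OF assms(1,2)]) simp
    finally show ?thesis .
  qed
  ultimately show ?thesis using assms(3) card by (auto simp: heavy_def)
qed

lemma pend_C4_attach_leaf:
  assumes "leaf V w x" "pend_C4 (V - {w}) a b c d" "x \<in> {a, b, c, d}"
  shows "pend_C4 V a b c d"
proof -
  let ?C = "{a, b, c, d}"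
  note L = leafD[OF assms(1)]
  have C: "?C \<subseteq> V - {w}" and C4: "C4 a b c d"
    using assms(2) by (auto simp: pend_C4_def)
  have fin: "finite (V - {w})" by (rule pend_C4_finite[OF assms(2)])
  have "\<exists>z\<in>?C. leaf V v z" if v: "v \<in> V - ?C" for v
  proof (cases "v = w")
    case True
    then show ?thesis using assms by blast
  next
    case False
    then obtain z where z: "z \<in> ?C" "leaf (V - {w}) v z"
      using pend_C4_leaf[OF assms(2)] v by blast
    have "\<not> E v w" using L(5)[of v] adj_sym v assms(3) by blast
    then have "leaf V v z" using z v by (auto simp: leaf_def)
    with z show ?thesis by blast
  qed
  moreover have "?C \<union> (V - ?C) = V" using C by auto
  ultimately have "pendants ?C (V - ?C)" using fin by (auto simp: pendants_def)
  then show ?thesis using C C4 by (auto simp: pend_C4_def)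
qed

text \<open>Removing \<open>w\<close> and then \<open>x\<close> leaves a 4-cycle with pendants on m
  vertices. Two uses of the leaf formula give three times its permanent plus four times its minor at
  the neighbour \<open>z\<close> of \<open>x\<close>, hence at least
  \<open>3 (24 m - 60) + 48\<close>, which exceeds \<open>44 (m + 2) - 160\<close> for
  \<open>m \<ge> 4\<close>.\<close>

lemma heavy_attach_far_leaf:
  assumes "leaf V w x" "pend_C4 (V - {w}) a b c d" "x \<notin> {a, b, c, d}"
  shows "heavy V"
proof -
  let ?V' = "V - {w}" and ?V'' = "V - {w} - {x}"
  note L = leafD[OF assms(1)]
  have x: "x \<in> ?V' - {a, b, c, d}" using L assms(3) by auto
  have fin': "finite ?V'" and fin: "finite V" using pend_C4_finite[OF assms(2)] by simp_all
  obtain z where z: "z \<in> {a, b, c, d}" "leaf ?V' x z" by (rule pend_C4_leaf[OF assms(2) x])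
  note L' = leafD[OF z(2)]
  have p'': "pend_C4 ?V'' a b c d" by (rule pend_C4_remove[OF assms(2) x])
  have "card V = Suc (card ?V')" "card ?V' = Suc (card ?V'')"
    by (rule card.remove; use L x fin in simp)+
  then have card: "card V = card ?V'' + 2" by simp
  have "card {a, b, c, d} \<le> card ?V''"
    using p'' fin by (intro card_mono) (auto simp: pend_C4_def)
  moreover have "card {a, b, c, d} = 4" using p'' by (auto simp: pend_C4_def C4_def)
  ultimately have card4: "4 \<le> card ?V''" by simp
  have z'': "z \<in> ?V''" using L' by auto
  have f'': "24 * int (card ?V'') - 60 \<le> lper ?V''" "12 \<le> lper_del ?V'' z"
    using lper_pend_C4_ge[OF p''] lper_del_pend_C4_ge[OF p'' z''] by auto
  \<comment> \<open>Deleting \<open>x\<close> leaves the edge to \<open>x\<close> in the diagonal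
    entry of \<open>z\<close>, hence one extra unit there.\<close>
  have del_x: "lper_del ?V' x = lper ?V'' + lper_del ?V'' z"
  proof -
    have "lper_del ?V' x = wper E ?V'' ((dg ?V'')(z := dg ?V'' z + 1))"
      unfolding lper_del_def
      by (rule wper_cong) (use dg_leaf_remove[OF fin' z(2)] in auto)
    also have "\<dots> = lper ?V'' + lper_del ?V'' z"
      using wper_add[of ?V'' z E "dg ?V''" 1] fin z'' by (simp add: lper_def lper_del_def)
    finally show ?thesis .
  qed
  have "lper V = 3 * lper ?V'' + 4 * lper_del ?V'' z"
    using lper_leaf[OF fin assms(1)] lper_leaf[OF fin' z(2)] del_x by simp
  then have "44 * int (card V) - 160 < lper V" using f'' card card4 by simp
  moreover have "22 \<le> lper_del V u" if u: "u \<in> V" for u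
  proof -
    consider "u = w" | "u = x" | "u \<in> ?V''" using u by auto
    then show ?thesis
    proof cases
      case 1
      then show ?thesis
        using lper_le_lper_del_leaf[OF fin L(1)] lper_pend_C4_ge(2)[OF assms(2)] by simp
    next
      case 2
      have "lper ?V'' \<le> lper_del ?V' x"
        by (rule lper_le_lper_del_leaf) (use fin L in auto)
      also have "\<dots> \<le> lper_del V x"
        using lper_del_leaf_mono[OF fin assms(1), of x] L by auto
      finally show ?thesis using 2 lper_pend_C4_ge(2)[OF p''] by simp
    next
      case 3
      have "lper_del V u = wper E (?V' - {u}) ((dg ?V')(x := dg ?V' x + 2))"
        unfolding lper_del_def using 3 by (intro wper_remove_leaf fin assms) auto
      also have "\<dots> = lper_del ?V' u + 2 * wper E (?V' - {u} - {x}) (dg ?V')"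
        unfolding lper_del_def by (rule wper_add) (use fin L 3 in auto)
      also have "?V' - {u} - {x} = ?V'' - {u}" by auto
      finally have "lper_del V u = lper_del ?V' u + 2 * wper E (?V'' - {u}) (dg ?V')" .
      \<comment> \<open>The minor on the right is at least 12 and enters the previous equation
        twice, giving 24.\<close>
      moreover have "lper_del ?V'' u \<le> wper E (?V'' - {u}) (dg ?V')"
        unfolding lper_del_def
        by (rule wper_mono) (use dg_leaf_remove[OF fin' z(2)] in auto)
      ultimately show ?thesis
        using lper_del_pend_C4_ge[OF p'' 3] lper_del_nonneg[of ?V' u] by linarith
    qed
  qed
  ultimately show ?thesis using card card4 by (auto simp: heavy_def)
qed

section \<open>Edges and connectivity of induced subgraphs\<close>

definition edges :: "'a set \<Rightarrow> ('a \<times> 'a) set" where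
  "edges V = {(i, j). i \<in> V \<and> j \<in> V \<and> i < j \<and> E i j}"

definition adj_rel :: "'a set \<Rightarrow> ('a \<times> 'a) set" where
  "adj_rel V = {(i, j). i \<in> V \<and> j \<in> V \<and> E i j}"

definition conn :: "'a set \<Rightarrow> bool" where
  "conn V \<longleftrightarrow> (\<forall>u\<in>V. \<forall>v\<in>V. (u, v) \<in> (adj_rel V)\<^sup>*)"

lemma finite_edges: "finite V \<Longrightarrow> finite (edges V)"
  by (rule finite_subset[of _ "V \<times> V"]) (auto simp: edges_def)

lemma card_edges_remove:
  assumes "finite V" "w \<in> V"
  shows "card (edges V) = card (edges (V - {w})) + card {j \<in> V. E w j}"
proof -
  \<comment> \<open>\<open>?e j\<close> is the ordered pair that stores the edge between
    \<open>j\<close> and \<open>w\<close>.\<close>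
  let ?N = "{j \<in> V. E w j}" and ?e = "\<lambda>j. (min j w, max j w)"
  have "edges V = edges (V - {w}) \<union> ?e ` ?N"
  proof (intro equalityI subsetI)
    fix p assume "p \<in> edges V"
    then obtain i j where p: "p = (i, j)" "i \<in> V" "j \<in> V" "i < j" "E i j"
      by (auto simp: edges_def)
    consider "i = w" | "j = w" | "i \<noteq> w" "j \<noteq> w" by blast
    then show "p \<in> edges (V - {w}) \<union> ?e ` ?N"
    proof cases
      case 1
      then have "p = ?e j" "j \<in> ?N" using p by auto
      then show ?thesis by blast
    next
      case 2
      then have "p = ?e i" "i \<in> ?N" using p adj_sym by auto
      then show ?thesis by blast
    next
      case 3
      then show ?thesis using p by (auto simp: edges_def)
    qed
  next
    fix p assume "p \<in> edges (V - {w}) \<union> ?e ` ?N"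
    then show "p \<in> edges V"
    proof
      assume "p \<in> ?e ` ?N"
      then obtain j where j: "p = ?e j" "j \<in> V" "E w j" by blast
      then have "j < w \<or> w < j" by (metis adj_irrefl linorder_neqE)
      then show ?thesis using j assms(2) adj_sym[of w j] by (auto simp: edges_def)
    qed (auto simp: edges_def)
  qed
  moreover have "edges (V - {w}) \<inter> ?e ` ?N = {}"
    by (auto simp: edges_def min_def max_def split: if_splits)
  moreover have "inj_on ?e ?N"
    by (rule inj_onI) (auto simp: min_def max_def split: if_splits)
  ultimately show ?thesis
    using assms(1) by (simp add: card_Un_disjoint finite_edges card_image)
qed

lemma handshake:
  assumes "finite V"
  shows "(\<Sum>v\<in>V. card {j \<in> V. E v j}) = 2 * card (edges V)"
  using assms
proof (induction V)
  case empty
  then show ?case by (simp add: edges_def)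
next
  case (insert w U)
  have "card {j \<in> insert w U. E v j} = card {j \<in> U. E v j} + (if E w v then 1 else 0)"
    if "v \<in> U" for v
  proof -
    have "{j \<in> insert w U. E v j} =
        (if E w v then insert w {j \<in> U. E v j} else {j \<in> U. E v j})"
      using adj_sym[of w v] by auto
    then show ?thesis using insert.hyps by simp
  qed
  then have "(\<Sum>v\<in>U. card {j \<in> insert w U. E v j}) =
      (\<Sum>v\<in>U. card {j \<in> U. E v j}) + (\<Sum>v\<in>U. if E w v then 1 else 0)"
    by (simp add: sum.distrib)
  moreover have "(\<Sum>v\<in>U. if E w v then 1 else 0) = card {j \<in> U. E w j}"
    using insert.hyps by (simp add: sum.If_cases Int_def)
  moreover have "{j \<in> insert w U. E w j} = {j \<in> U. E w j}" by auto
  moreover have "card (edges (insert w U)) = card (edges U) + card {j \<in> insert w U. E w j}"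
    using card_edges_remove[of "insert w U" w] insert.hyps by simp
  ultimately show ?case using insert by simp
qed

lemma conn_remove_leaf:
  assumes "conn V" "leaf V w x"
  shows "conn (V - {w})"
  unfolding conn_def
proof (intro ballI)
  let ?R = "(adj_rel (V - {w}))\<^sup>*"
  note L = leafD[OF assms(2)]
  fix u v assume uv: "u \<in> V - {w}" "v \<in> V - {w}"
  \<comment> \<open>Sending \<open>w\<close> to \<open>x\<close> retracts walks: a step into or out
    of \<open>w\<close> becomes stationary at \<open>x\<close>, and all other steps survive in
    \<open>V - {w}\<close>.\<close>
  have path: "(u, if z = w then x else z) \<in> ?R" if "(u, z) \<in> (adj_rel V)\<^sup>*" for z
    using that
  proof (induction rule: rtrancl_induct)
    case base
    then show ?case using uv by simp
  next
    case (step y z)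
    have yz: "y \<in> V" "z \<in> V" "E y z" using step.hyps by (auto simp: adj_rel_def)
    consider "y = w" | "z = w" "y \<noteq> w" | "y \<noteq> w" "z \<noteq> w" by blast
    then show ?case
    proof cases
      case 1
      then have "z = x" using yz L by auto
      then show ?thesis using step.IH 1 L(3) by simp
    next
      case 2
      then have "y = x" using yz L(5)[of y] adj_sym by blast
      then show ?thesis using step.IH 2 by simp
    next
      case 3
      then have "(y, z) \<in> adj_rel (V - {w})" using yz by (auto simp: adj_rel_def)
      then show ?thesis using step.IH 3 by simp
    qed
  qed
  have "(u, v) \<in> (adj_rel V)\<^sup>*" using assms(1) uv by (auto simp: conn_def)
  from path[OF this] uv show "(u, v) \<in> ?R" by simp
qed

lemma conn_isolated:
  assumes "conn V" "w \<in> V" "{j \<in> V. E w j} = {}"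
  shows "V = {w}"
proof -
  have "v = w" if "v \<in> V" for v
  proof -
    have "(w, v) \<in> (adj_rel V)\<^sup>*" using assms that by (auto simp: conn_def)
    then show ?thesis
    proof (cases rule: converse_rtranclE)
      case (step y)
      then have "y \<in> {j \<in> V. E w j}" by (auto simp: adj_rel_def)
      then show ?thesis using assms(3) by simp
    qed simp
  qed
  then show ?thesis using assms(2) by blast
qed

section \<open>Classification of bipartite unicyclic graphs\<close>

text \<open>The right side is the bound of \<open>wper_const2_lower_bound\<close> for
  \<open>n\<close> vertices and \<open>n\<close> edges. At \<open>n = 5\<close> the claim is
  \<open>60 < 72\<close>, and each further vertex adds more than 44 on the right.\<close>

lemma linear_less_power2:
  assumes "5 \<le> n"
  shows "44 * int n - 160 < 2 ^ n + int n * 2 ^ (n - 2)"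
  using assms
proof (induction n rule: nat_induct_at_least)
  case (Suc n)
  have "(8::int) \<le> 2 ^ (n - 2)" using power_increasing[of 3 "n - 2" "2::int"] Suc.hyps by simp
  moreover have "(32::int) \<le> 2 ^ n" using power_increasing[of 5 n "2::int"] Suc.hyps by simp
  moreover have "(2::int) ^ (Suc n - 2) = 2 * 2 ^ (n - 2)" using Suc.hyps by (simp flip: power_Suc add: Suc_diff_le)
  moreover have "5 * 2 ^ (n - 2) \<le> int n * 2 ^ (n - 2)" using Suc.hyps by (intro mult_right_mono) auto
  ultimately show ?case using Suc.IH by (simp add: distrib_right)
qed simp

text \<open>The colouring makes the walk d, a, b, c consist of four distinct vertices. If these are
  all, they form a 4-cycle; otherwise there are at least five vertices and the transposition bound
  applies to the graph and to its minors.\<close>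

lemma two_regular:
  assumes "finite V" "V \<noteq> {}" "\<And>v. v \<in> V \<Longrightarrow> card {j \<in> V. E v j} = 2"
    and col: "\<And>u v. u \<in> V \<Longrightarrow> v \<in> V \<Longrightarrow> E u v \<Longrightarrow> col u \<noteq> (col v :: bool)"
  shows "(\<exists>a b c d. pend_C4 V a b c d) \<or> heavy V"
proof -
  obtain a where a: "a \<in> V" using assms(2) by auto
  obtain b d where bd: "{j \<in> V. E a j} = {b, d}" "b \<noteq> d"
    using assms(3)[OF a] by (auto simp: card_2_iff)
  then have bd': "b \<in> V" "d \<in> V" "E a b" "E a d" by auto
  have "a \<in> {j \<in> V. E b j}" using a bd' adj_sym by blast
  then have "card ({j \<in> V. E b j} - {a}) = 1" using assms(3)[OF bd'(1)] by simp
  then obtain c where "{j \<in> V. E b j} - {a} = {c}" by (rule card_1_singletonE)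
  then have c: "{j \<in> V. E b j} = {a, c}" "a \<noteq> c" using \<open>a \<in> {j \<in> V. E b j}\<close> by auto
  then have c': "c \<in> V" "E b c" by auto
  have colours: "col b \<noteq> col a" "col d \<noteq> col a" "col c = col a" using col a bd' c' by metis+
  then have dist: "distinct [a, b, c, d]" using bd c by auto
  have "card {a, b, c, d} \<le> card V" using a bd' c' assms(1) by (intro card_mono) auto
  then have "4 \<le> card V" using dist by simp
  then consider "card V = 4" | "5 \<le> card V" by linarith
  then show ?thesis
  proof cases
    case 1
    have V: "V = {a, b, c, d}"
      by (rule card_subset_eq[symmetric]) (use 1 dist a bd' c' assms(1) in auto)
    \<comment> \<open>The second neighbour of \<open>d\<close> cannot be \<open>b\<close>, which has
      the same colour, so only \<open>c\<close> is left.\<close>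
    have "E c d"
    proof (rule ccontr)
      assume "\<not> E c d"
      then have "{j \<in> V. E d j} \<subseteq> {a}" using V colours col[of b d] bd' adj_sym by auto
      then have "card {j \<in> V. E d j} \<le> card {a}" by (intro card_mono) auto
      then show False using assms(3)[OF bd'(2)] by simp
    qed
    moreover have "\<not> E a c" "\<not> E b d" using col a bd' c' colours by metis+
    ultimately have "C4 a b c d" using dist bd' c' adj_sym by (auto simp: C4_def)
    then have "pend_C4 V a b c d" using V by (auto simp: pend_C4_def pendants_def)
    then show ?thesis by blast
  next
    case 2
    have dg2: "dg V v = 2" if "v \<in> V" for v using assms(3)[OF that] by (simp add: dg_def)
    have card_e: "card (edges V) = card V" using handshake[OF assms(1)] assms(3) by simp
    have "2 ^ card V + int (card (edges V)) * 2 ^ (card V - 2) \<le> wper E V (\<lambda>_. 2)"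
      by (rule wper_const2_lower_bound[OF assms(1) symp_E]) (simp add: edges_def)
    also have "wper E V (\<lambda>_. 2) = lper V" unfolding lper_def by (rule wper_cong) (simp add: dg2)
    finally have "44 * int (card V) - 160 < lper V"
      using linear_less_power2[OF 2] card_e by simp
    moreover have "22 \<le> lper_del V u" if u: "u \<in> V" for u
    proof -
      let ?W = "V - {u}"
      \<comment> \<open>The minor keeps diagonal 2 on at least four vertices. Already two remaining
        edges give \<open>16 + 2 * 4 = 24\<close>.\<close>
      have W: "card V = Suc (card ?W)" using u assms(1) by (intro card.remove)
      have "card (edges V) = card (edges ?W) + 2"
        using card_edges_remove[OF assms(1) u] assms(3)[OF u] by simp
      then have e: "2 \<le> card (edges ?W)" using card_e 2 by simp
      have p4: "(4::int) \<le> 2 ^ (card ?W - 2)" using power_increasing[of 2 "card ?W - 2" "2::int"] W 2 by simp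
      have "2 * 4 \<le> int (card (edges ?W)) * 2 ^ (card ?W - 2)" using e p4 by (intro mult_mono) auto
      moreover have "(16::int) \<le> 2 ^ card ?W" using power_increasing[of 4 "card ?W" "2::int"] W 2 by simp
      moreover have "2 ^ card ?W + int (card (edges ?W)) * 2 ^ (card ?W - 2) \<le> wper E ?W (\<lambda>_. 2)"
        by (rule wper_const2_lower_bound) (use assms(1) symp_E in \<open>auto simp: edges_def\<close>)
      moreover have "wper E ?W (\<lambda>_. 2) = lper_del V u"
        unfolding lper_del_def by (rule wper_cong) (simp add: dg2)
      ultimately show ?thesis by linarith
    qed
    ultimately show ?thesis using 2 by (auto simp: heavy_def)
  qed
qed

lemma unicyclic_cases:
  assumes "finite V" "V \<noteq> {}" "conn V" "card (edges V) = card V"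
    and "\<And>u v. u \<in> V \<Longrightarrow> v \<in> V \<Longrightarrow> E u v \<Longrightarrow> col u \<noteq> (col v :: bool)"
  shows "(\<exists>a b c d. pend_C4 V a b c d) \<or> heavy V"
  using assms
proof (induction "card V" arbitrary: V rule: less_induct)
  case less
  show ?case
  proof (cases "\<exists>w\<in>V. card {j \<in> V. E w j} \<le> 1")
    case True
    then obtain w where w: "w \<in> V" "card {j \<in> V. E w j} \<le> 1" by blast
    \<comment> \<open>An isolated vertex of a connected graph is the whole graph, which then has one
      vertex and no edge.\<close>
    have "{j \<in> V. E w j} \<noteq> {}"
    proof
      assume "{j \<in> V. E w j} = {}"
      then have "V = {w}" using less.prems w by (intro conn_isolated)
      moreover have "edges {w} = {}" by (auto simp: edges_def)
      ultimately show False using less.prems(4) by simp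
    qed
    then have "card {j \<in> V. E w j} \<noteq> 0" using less.prems(1) by simp
    then have "card {j \<in> V. E w j} = 1" using w(2) by linarith
    then obtain x where lf: "leaf V w x" using w by (auto simp: leaf_def card_1_singleton_iff)
    note L = leafD[OF lf]
    have W: "card V = Suc (card (V - {w}))" using w less.prems(1) by (intro card.remove)
    have e: "card (edges (V - {w})) = card (V - {w})"
      using card_edges_remove[OF less.prems(1) w(1)] less.prems(4) W \<open>card {j \<in> V. E w j} = 1\<close> by simp
    have "(\<exists>a b c d. pend_C4 (V - {w}) a b c d) \<or> heavy (V - {w})"
    proof (rule less.hyps)
      show "card (V - {w}) < card V" using W by simp
      show "finite (V - {w})" using less.prems(1) by simp
      show "V - {w} \<noteq> {}" using L(2,3) by blast
      show "conn (V - {w})" by (rule conn_remove_leaf[OF less.prems(3) lf])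
      show "col u \<noteq> col v" if "u \<in> V - {w}" "v \<in> V - {w}" "E u v" for u v
        using less.prems(5) that by blast
    qed (rule e)
    then show ?thesis
      using heavy_attach_leaf[OF less.prems(1) lf] pend_C4_attach_leaf[OF lf]
        heavy_attach_far_leaf[OF lf] by blast
  next
    case False
    \<comment> \<open>With all degrees at least 2 and degree sum \<open>2 * card V\<close>, every
      degree equals 2.\<close>
    have ge: "2 \<le> card {j \<in> V. E v j}" if "v \<in> V" for v
    proof (rule ccontr)
      assume "\<not> 2 \<le> card {j \<in> V. E v j}"
      then have "card {j \<in> V. E v j} \<le> 1" by linarith
      with False that show False by blast
    qed
    have "card {j \<in> V. E v j} = 2" if v: "v \<in> V" for v
    proof (rule ccontr)
      assume "card {j \<in> V. E v j} \<noteq> 2"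
      then have "2 < card {j \<in> V. E v j}" using ge[OF v] by linarith
      then have "(\<Sum>v\<in>V. 2) < (\<Sum>v\<in>V. card {j \<in> V. E v j})"
        using ge v by (intro sum_strict_mono_ex1 less.prems(1)) blast+
      then show False
        unfolding handshake[OF less.prems(1)] less.prems(4) by simp
    qed
    then show ?thesis
      by (rule two_regular[OF less.prems(1,2) _ less.prems(5)])
  qed
qed

end

text \<open>Labels \<open>0\<close>--\<open>3\<close> are the core vertices, and \<open>4 + i\<close> is the class of pendant vertices
  attached to core vertex \<open>i\<close>.\<close>

definition label_adj :: "nat \<Rightarrow> nat \<Rightarrow> bool" where
  "label_adj i j \<longleftrightarrow> (i, j) \<in> {(0, 1), (1, 2), (2, 3), (3, 0), (0, 4), (1, 5), (2, 6), (3, 7)} \<or>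
     (j, i) \<in> {(0, 1), (1, 2), (2, 3), (3, 0), (0, 4), (1, 5), (2, 6), (3, 7)}"

section \<open>Labels as complete isomorphism data\<close>

context sgraph
begin

definition label :: "'a \<Rightarrow> 'a \<Rightarrow> 'a \<Rightarrow> 'a \<Rightarrow> 'a \<Rightarrow> nat" where
  "label a b c d v = (if v = a then 0 else if v = b then 1 else if v = c then 2
     else if v = d then 3 else if E v a then 4 else if E v b then 5 else if E v c then 6 else 7)"

lemma label_core:
  assumes "C4 a b c d"
  shows "label a b c d a = 0" "label a b c d b = 1" "label a b c d c = 2" "label a b c d d = 3"
  using assms by (auto simp: label_def C4_def)

lemma label_pendant:
  assumes "pend_C4 V a b c d" "w \<in> V - {a, b, c, d}"
  obtains x where "x \<in> {a, b, c, d}" "label a b c d w = 4 + label a b c d x"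
    "\<And>v. v \<in> V \<Longrightarrow> E w v \<longleftrightarrow> v = x"
proof -
  obtain x where x: "x \<in> {a, b, c, d}" "leaf V w x" by (rule pend_C4_leaf[OF assms])
  have nb: "\<And>v. v \<in> V \<Longrightarrow> E w v \<longleftrightarrow> v = x" by (rule leafD(5)[OF x(2)])
  have C4: "C4 a b c d" and C: "a \<in> V" "b \<in> V" "c \<in> V" "d \<in> V"
    using assms(1) by (auto simp: pend_C4_def)
  have "label a b c d w = (if a = x then 4 else if b = x then 5 else if c = x then 6 else 7)"
    using assms(2) nb[OF C(1)] nb[OF C(2)] nb[OF C(3)] by (simp add: label_def)
  also have "\<dots> = 4 + label a b c d x"
    using x(1) C4 label_core[OF C4] by (auto simp: C4_def)
  finally show ?thesis using that x(1) nb by blast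
qed

text \<open>Adjacency depends on the labels alone, so the sizes of the label classes, that is the
  four pendant counts, determine the graph up to isomorphism.\<close>

lemma adj_iff_label_adj:
  assumes "pend_C4 V a b c d" "u \<in> V" "v \<in> V"
  shows "E u v \<longleftrightarrow> label_adj (label a b c d u) (label a b c d v)"
proof -
  let ?C = "{a, b, c, d}" and ?l = "label a b c d"
  have C4: "C4 a b c d" using assms(1) by (auto simp: pend_C4_def)
  note core = label_core[OF C4]
  have adj: "E a b" "E b a" "E b c" "E c b" "E c d" "E d c" "E d a" "E a d"
    "\<not> E a c" "\<not> E c a" "\<not> E b d" "\<not> E d b"
    using C4 adj_sym by (auto simp: C4_def)
  have lt: "?l x < 4" if "x \<in> ?C" for x using that core by auto
  have inj: "?l x = ?l z \<longleftrightarrow> x = z" if "x \<in> ?C" "z \<in> ?C" for x z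
    using that core C4 by (auto simp: C4_def)
  have pend: "E w z \<longleftrightarrow> label_adj (?l w) (?l z)" if w: "w \<in> V - ?C" and z: "z \<in> V" for w z
  proof -
    obtain x where x: "x \<in> ?C" "?l w = 4 + ?l x" and nb: "\<And>v. v \<in> V \<Longrightarrow> E w v \<longleftrightarrow> v = x"
      by (rule label_pendant[OF assms(1) w]) blast
    show ?thesis
    proof (cases "z \<in> ?C")
      case True
      have "label_adj (4 + ?l x) (?l z) \<longleftrightarrow> ?l x = ?l z"
        using lt[OF x(1)] lt[OF True] by (auto simp: label_adj_def)
      then show ?thesis using inj[OF x(1) True] nb[OF z] x(2) by auto
    next
      case False
      with z have "z \<in> V - ?C" by simp
      then obtain y where y: "y \<in> ?C" "?l z = 4 + ?l y"
        by (rule label_pendant[OF assms(1)]) blast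
      have "\<not> label_adj (4 + ?l x) (4 + ?l y)" by (auto simp: label_adj_def)
      moreover have "\<not> E w z" using nb[OF z] x(1) False by blast
      ultimately show ?thesis using x(2) y(2) by simp
    qed
  qed
  consider "u \<notin> ?C" | "v \<notin> ?C" | "u \<in> ?C" "v \<in> ?C" by blast
  then show ?thesis
  proof cases
    case 1
    then show ?thesis using pend[of u v] assms(2,3) by blast
  next
    case 2
    then have "E v u \<longleftrightarrow> label_adj (?l v) (?l u)" using pend[of v u] assms(2,3) by blast
    moreover have "label_adj (?l v) (?l u) \<longleftrightarrow> label_adj (?l u) (?l v)"
      unfolding label_adj_def by (rule disj_commute)
    ultimately show ?thesis using adj_sym[of u v] by simp
  next
    case 3
    then show ?thesis
      by (elim insertE emptyE) (simp_all add: adj core label_adj_def)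
  qed
qed

lemma card_label:
  assumes "pend_C4 V a b c d"
  shows "card {v \<in> V. label a b c d v = l} =
    (if l < 4 then 1 else if l = 4 then npend V a b c d a else if l = 5 then npend V a b c d b
     else if l = 6 then npend V a b c d c else if l = 7 then npend V a b c d d else 0)"
proof -
  let ?C = "{a, b, c, d}" and ?l = "label a b c d"
  have C4: "C4 a b c d" and C: "a \<in> V" "b \<in> V" "c \<in> V" "d \<in> V"
    using assms(1) by (auto simp: pend_C4_def)
  note core = label_core[OF C4]
  have pend: "4 \<le> ?l w \<and> ?l w < 8 \<and> (?l w = 4 \<longleftrightarrow> E w a) \<and> (?l w = 5 \<longleftrightarrow> E w b) \<and>
      (?l w = 6 \<longleftrightarrow> E w c) \<and> (?l w = 7 \<longleftrightarrow> E w d)" if w: "w \<in> V - ?C" for w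
  proof -
    obtain x where x: "x \<in> ?C" "?l w = 4 + ?l x" and nb: "\<And>v. v \<in> V \<Longrightarrow> E w v \<longleftrightarrow> v = x"
      by (rule label_pendant[OF assms w]) blast
    from x(1) show ?thesis
      unfolding x(2) nb[OF C(1)] nb[OF C(2)] nb[OF C(3)] nb[OF C(4)]
      using core C4 by (auto simp: C4_def)
  qed
  have split: "{v \<in> V. ?l v = l} = {v \<in> ?C. ?l v = l} \<union> {w \<in> V - ?C. ?l w = l}"
    using C by auto
  show ?thesis
  proof (cases "l < 4")
    case True
    then have none: "{w \<in> V - ?C. ?l w = l} = {}" using pend by fastforce
    have one: "{v \<in> ?C. ?l v = l} = {[a, b, c, d] ! l}"
    proof -
      from True consider "l = 0" | "l = 1" | "l = 2" | "l = 3" by linarith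
      then show ?thesis by cases (use core in auto)
    qed
    show ?thesis unfolding split none one using True by simp
  next
    case False
    then have none: "{v \<in> ?C. ?l v = l} = {}" using core by auto
    have eq: "{w \<in> V - ?C. ?l w = l} = (if l = 4 then {w \<in> V - ?C. E w a}
        else if l = 5 then {w \<in> V - ?C. E w b} else if l = 6 then {w \<in> V - ?C. E w c}
        else if l = 7 then {w \<in> V - ?C. E w d} else {})"
    proof (rule set_eqI)
      fix w
      show "w \<in> {w \<in> V - ?C. ?l w = l} \<longleftrightarrow> w \<in> (if l = 4 then {w \<in> V - ?C. E w a}
        else if l = 5 then {w \<in> V - ?C. E w b} else if l = 6 then {w \<in> V - ?C. E w c}
        else if l = 7 then {w \<in> V - ?C. E w d} else {})"
      proof (cases "w \<in> V - ?C")
        case True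
        from pend[OF True] \<open>\<not> l < 4\<close> show ?thesis using True by auto
      qed auto
    qed
    show ?thesis unfolding split none eq using False by (simp add: npend_def)
  qed
qed

end

section \<open>Isomorphism\<close>

text \<open>Equal class sizes mean equal multisets of labels, so some permutation of the vertices
  carries \<open>s\<close> to \<open>t\<close>; it preserves adjacency because both relations factor
  through \<open>R\<close>.\<close>

lemma graph_iso_by_labels:
  assumes "\<And>i j. i < n \<Longrightarrow> j < n \<Longrightarrow> E i j \<longleftrightarrow> R (s i) (s j)"
    and "\<And>i j. i < n \<Longrightarrow> j < n \<Longrightarrow> F i j \<longleftrightarrow> R (t i) (t j)"
    and "\<And>l. card {v \<in> {..<n}. s v = l} = card {v \<in> {..<n}. t v = l}"
  shows "graph_iso n E F"
proof -
  have "image_mset s (mset_set {..<n}) = image_mset t (mset_set {..<n})"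
    by (rule multiset_eqI) (simp only: count_image_mset_eq_card_vimage[OF finite_lessThan] assms(3))
  then obtain p where p: "p permutes {..<n}" "\<forall>v\<in>{..<n}. s v = t (p v)"
    using image_mset_eq_implies_permutes[OF finite_lessThan] by blast
  have "E i j \<longleftrightarrow> F (p i) (p j)" if "i < n" "j < n" for i j
    using assms(1)[OF that] assms(2)[of "p i" "p j"] p(2) that permutes_in_image[OF p(1)] by simp
  then show ?thesis
    unfolding graph_iso_def using permutes_imp_bij[OF p(1)] by blast
qed

lemma lap_per_iso:
  assumes "graph_iso n E F"
  shows "lap_per n E = lap_per n F"
proof -
  obtain \<sigma> where bij: "bij_betw \<sigma> {..<n} {..<n}"
    and iso: "\<And>i j. i < n \<Longrightarrow> j < n \<Longrightarrow> E i j \<longleftrightarrow> F (\<sigma> i) (\<sigma> j)"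
    using assms by (auto simp: graph_iso_def)
  have deg: "degree n F (\<sigma> i) = degree n E i" if "i < n" for i
  proof -
    have "bij_betw \<sigma> {j. j < n \<and> E i j} (\<sigma> ` {j. j < n \<and> E i j})"
      by (rule bij_betw_subset[OF bij]) auto
    moreover have "\<sigma> ` {j. j < n \<and> E i j} = {j. j < n \<and> F (\<sigma> i) j}"
      using iso[OF that] bij unfolding bij_betw_def by (auto simp: image_iff) (metis imageE lessThan_iff)+
    ultimately show ?thesis by (simp add: degree_def bij_betw_same_card)
  qed
  have "per_on {..<n} (laplacian n F) = per_on {..<n} (\<lambda>i j. laplacian n F (\<sigma> i) (\<sigma> j))"
    by (rule per_on_reindex[OF bij]) simp
  also have "\<dots> = per_on {..<n} (laplacian n E)"
  proof (rule per_on_cong)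
    fix i j assume ij: "i \<in> {..<n}" "j \<in> {..<n}"
    then have "\<sigma> i = \<sigma> j \<longleftrightarrow> i = j" using bij by (auto simp: bij_betw_def inj_on_def)
    then show "laplacian n F (\<sigma> i) (\<sigma> j) = laplacian n E i j"
      using ij iso deg by (simp add: laplacian_def)
  qed
  finally show ?thesis by (simp add: lap_per_def per_eq_per_on)
qed

section \<open>The model graphs and their permanents\<close>

lemma sgraph_C4_pend: "sgraph (C4_pend p q r s)"
  by standard (auto simp: C4_pend_def symp_def irreflp_def)

lemma C4_pend_core:
  assumes "u < 4" "v < 4"
  shows "C4_pend p q r s u v \<longleftrightarrow> v = (u + 1) mod 4 \<or> u = (v + 1) mod 4"
proof -
  have "u = 0 \<or> u = 1 \<or> u = 2 \<or> u = 3" using assms by linarith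
  then show ?thesis using assms by (auto simp: C4_pend_def)
qed

lemma C4_pend_pendant:
  assumes "4 \<le> w"
  shows "C4_pend p q r s w v \<longleftrightarrow> w < 4 + p + q + r + s \<and> v = pend_owner p q r w"
  using assms by (auto simp: C4_pend_def pend_owner_def split: if_splits)

lemma pend_C4_C4_pend:
  assumes "n = 4 + p + q + r + s"
  shows "sgraph.pend_C4 (C4_pend p q r s) {..<n} 0 1 2 3"
proof -
  interpret sgraph "C4_pend p q r s" by (rule sgraph_C4_pend)
  have "C4 0 1 2 3" by (simp add: C4_def C4_pend_core)
  moreover have "\<exists>x\<in>{0, 1, 2, 3}. leaf {..<n} w x" if w: "w \<in> {..<n} - {0, 1, 2, 3}" for w
  proof
    have w4: "4 \<le> w" "w < n" using w by auto
    show "leaf {..<n} w (pend_owner p q r w)"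
      using w4 assms by (auto simp: leaf_def C4_pend_pendant) (auto simp: pend_owner_def)
    show "pend_owner p q r w \<in> {0, 1, 2, 3}" by (simp add: pend_owner_def)
  qed
  moreover have "{0, 1, 2, 3} \<union> ({..<n} - {0, 1, 2, 3}) = {..<n}" using assms by auto
  ultimately show ?thesis using assms by (auto simp: pend_C4_def pendants_def)
qed

lemma npend_C4_pend:
  assumes "n = 4 + p + q + r + s"
  shows "sgraph.npend (C4_pend p q r s) {..<n} 0 1 2 3 0 = p"
    "sgraph.npend (C4_pend p q r s) {..<n} 0 1 2 3 1 = q"
    "sgraph.npend (C4_pend p q r s) {..<n} 0 1 2 3 2 = r"
    "sgraph.npend (C4_pend p q r s) {..<n} 0 1 2 3 3 = s"
proof -
  interpret sgraph "C4_pend p q r s" by (rule sgraph_C4_pend)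
  have *: "npend {..<n} 0 1 2 3 x = card {w \<in> {4..<n}. pend_owner p q r w = x}" for x
    unfolding npend_def
    by (rule arg_cong[where f = card]) (use assms in \<open>auto simp: C4_pend_pendant\<close>)
  have "{w \<in> {4..<n}. pend_owner p q r w = 0} = {4..<4 + p}"
    "{w \<in> {4..<n}. pend_owner p q r w = 1} = {4 + p..<4 + p + q}"
    "{w \<in> {4..<n}. pend_owner p q r w = 2} = {4 + p + q..<4 + p + q + r}"
    "{w \<in> {4..<n}. pend_owner p q r w = 3} = {4 + p + q + r..<4 + p + q + r + s}"
    using assms by (auto simp: pend_owner_def split: if_splits)
  then show "npend {..<n} 0 1 2 3 0 = p" "npend {..<n} 0 1 2 3 1 = q"
    "npend {..<n} 0 1 2 3 2 = r" "npend {..<n} 0 1 2 3 3 = s"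
    unfolding * by simp_all
qed

lemma graph_iso_C4_pend:
  assumes "sgraph E" "sgraph.pend_C4 E {..<n} a b c d"
  shows "graph_iso n E (C4_pend (sgraph.npend E {..<n} a b c d a) (sgraph.npend E {..<n} a b c d b)
    (sgraph.npend E {..<n} a b c d c) (sgraph.npend E {..<n} a b c d d))"
proof -
  interpret G: sgraph E by (rule assms(1))
  let ?p = "G.npend {..<n} a b c d"
  let ?F = "C4_pend (?p a) (?p b) (?p c) (?p d)"
  interpret F: sgraph ?F by (rule sgraph_C4_pend)
  have n: "n = 4 + ?p a + ?p b + ?p c + ?p d" using G.card_pend_C4[OF assms(2)] by simp
  note F = pend_C4_C4_pend[OF n]
  show ?thesis
  proof (rule graph_iso_by_labels)
    show "E i j \<longleftrightarrow> label_adj (G.label a b c d i) (G.label a b c d j)" if "i < n" "j < n" for i j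
      using G.adj_iff_label_adj[OF assms(2)] that by simp
    show "?F i j \<longleftrightarrow> label_adj (F.label 0 1 2 3 i) (F.label 0 1 2 3 j)" if "i < n" "j < n" for i j
      using F.adj_iff_label_adj[OF F] that by simp
    show "card {v \<in> {..<n}. G.label a b c d v = l} = card {v \<in> {..<n}. F.label 0 1 2 3 v = l}" for l
      unfolding G.card_label[OF assms(2)] F.card_label[OF F] npend_C4_pend[OF n] ..
  qed
qed

text \<open>The polynomial of \<open>wper_C4\<close> at the weights
  \<open>2 + 2 p_i\<close>.\<close>

definition C4_pend_per :: "nat \<Rightarrow> nat \<Rightarrow> nat \<Rightarrow> nat \<Rightarrow> int" where
  "C4_pend_per p q r s = (let a = 2 + 2 * int p; b = 2 + 2 * int q; c = 2 + 2 * int r; d = 2 + 2 * int s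
     in a * b * c * d + a * b + b * c + c * d + d * a + 4)"

lemma lap_per_eq_lper:
  assumes "simple_graph n E" "bipartite n E"
  shows "lap_per n E = sgraph.lper E {..<n}"
proof -
  interpret sgraph E by standard (use assms(1) in \<open>auto simp: simple_graph_def symp_def irreflp_def\<close>)
  show ?thesis
    unfolding per_laplacian_eq_wper[OF assms] lper_def by (simp add: dg_def[abs_def] degree_def)
qed

lemma lap_per_C4_pend:
  assumes "n = 4 + p + q + r + s"
  shows "lap_per n (C4_pend p q r s) = C4_pend_per p q r s"
proof -
  let ?E = "C4_pend p q r s"
  interpret sgraph ?E by (rule sgraph_C4_pend)
  have simple: "simple_graph n ?E"
    using adj_sym assms by (auto simp: simple_graph_def) (auto simp: C4_pend_def)
  \<comment> \<open>The cycle is coloured by parity; a pendant gets the colour opposite to its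
    owner.\<close>
  define side where "side v = (if v < 4 then even v else odd (pend_owner p q r v))" for v
  have pend: "side w \<noteq> side v" if "4 \<le> w" "?E w v" for w v
    using that by (auto simp: C4_pend_pendant side_def pend_owner_def)
  have core: "side u \<noteq> side v" if "u < 4" "v < 4" "?E u v" for u v
  proof -
    have "v = (u + 1) mod 4 \<or> u = (v + 1) mod 4" using that C4_pend_core by blast
    moreover have "u = 0 \<or> u = 1 \<or> u = 2 \<or> u = 3" "v = 0 \<or> v = 1 \<or> v = 2 \<or> v = 3"
      using that(1,2) by linarith+
    ultimately show ?thesis by (auto simp: side_def)
  qed
  have "side u \<noteq> side v" if "?E u v" for u v
    using pend[of u v] pend[of v u] core[of u v] that adj_sym by (metis linorder_not_less)
  then have "bipartite n ?E" by (auto simp: bipartite_def)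
  with simple have "lap_per n ?E = lper {..<n}" by (rule lap_per_eq_lper)
  also have "\<dots> = C4_pend_per p q r s"
    unfolding lper_pend_C4[OF pend_C4_C4_pend[OF assms]] npend_C4_pend[OF assms]
    by (simp add: C4_pend_per_def Let_def)
  finally show ?thesis .
qed

section \<open>Comparing pendant distributions\<close>

lemma C4_pend_per_expand:
  "C4_pend_per p q r s = 36 + 24 * int (p + q + r + s) + 20 * (int (p + r) * int (q + s)) +
    16 * (int p * int r + int q * int s) +
    16 * (int p * int q * int r + int q * int r * int s + int r * int s * int p + int s * int p * int q +
      int p * int q * int r * int s)"
  by (simp add: C4_pend_per_def Let_def algebra_simps)

lemma product_ge_pred_sum:
  assumes "1 \<le> x" "1 \<le> (y::int)"
  shows "x + y - 1 \<le> x * y"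
proof -
  have "0 \<le> (x - 1) * (y - 1)" using assms by simp
  then show ?thesis by (simp add: algebra_simps)
qed

text \<open>Opposite counts enter with coefficient 16, below the 20 that the slope 44 requires.
  Hence \<open>(p - 1) (r - 1) \<ge> 0\<close> is too weak and
  \<open>(p - 2) (r - 2) \<ge> 0\<close> is used.\<close>

lemma C4_pend_per_opposite:
  assumes "2 \<le> p" "2 \<le> r"
  shows "44 * int (4 + p + r) - 160 < C4_pend_per p 0 r 0"
proof -
  have "0 \<le> (int p - 2) * (int r - 2)" using assms by simp
  then have "2 * int p + 2 * int r - 4 \<le> int p * int r" by (simp add: algebra_simps)
  then show ?thesis using assms by (simp add: C4_pend_per_expand)
qed

text \<open>The difference of the two sides is exactly \<open>20 (p - 1) (q - 1)\<close>; it
  vanishes for \<open>p = 1\<close>, the case of \<open>B(3, n - 3)\<close>.\<close>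

lemma C4_pend_per_adjacent:
  assumes "2 \<le> p" "2 \<le> q"
  shows "44 * int (4 + p + q) - 160 < C4_pend_per p q 0 0"
proof -
  have "0 < (int p - 1) * (int q - 1)" using assms by simp
  then have "int p + int q - 1 < int p * int q" by (simp add: algebra_simps)
  then show ?thesis by (simp add: C4_pend_per_expand)
qed

text \<open>The adjacent products alone reach the bound, by \<open>product_ge_pred_sum\<close>; the
  opposite pair \<open>p\<close>, \<open>r\<close> adds at least 16 and makes it strict.\<close>

lemma C4_pend_per_mixed:
  assumes "1 \<le> p" "1 \<le> r" "1 \<le> q + s"
  shows "44 * int (4 + p + q + r + s) - 160 < C4_pend_per p q r s"
proof -
  define A B C D where ABCD: "A = int (p + r) * int (q + s)" "B = int p * int r" "C = int q * int s"
    "D = int p * int q * int r + int q * int r * int s + int r * int s * int p + int s * int p * int q +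
      int p * int q * int r * int s"
  have "int (p + r) + int (q + s) - 1 \<le> A"
    unfolding ABCD by (rule product_ge_pred_sum) (use assms in auto)
  moreover have "1 \<le> B" using product_ge_pred_sum[of "int p" "int r"] assms by (simp add: ABCD)
  moreover have "0 \<le> C" "0 \<le> D" by (simp_all add: ABCD)
  moreover have "C4_pend_per p q r s = 36 + 24 * int (p + q + r + s) + 20 * A + 16 * (B + C) + 16 * D"
    unfolding C4_pend_per_expand ABCD by (rule refl)
  ultimately show ?thesis by simp
qed

lemma C4_pend_per_rotate: "C4_pend_per q r s p = C4_pend_per p q r s"
  by (simp add: C4_pend_per_def Let_def algebra_simps)

text \<open>\<open>I\<close> stands for being isomorphic to the model with the given counts; the
  eight tuples are the orbit under the symmetries of the square.\<close>

lemma pend_distribution_cases: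
  assumes n: "n = 4 + p + q + r + s"
    and I: "\<And>p' q' r' s'. (p', q', r', s') \<in> {(p, q, r, s), (q, r, s, p), (r, s, p, q), (s, p, q, r),
      (p, s, r, q), (q, p, s, r), (r, q, p, s), (s, r, q, p)} \<Longrightarrow> I p' q' r' s'"
  shows "I 0 (n - 4) 0 0 \<or> 6 \<le> n \<and> I 1 0 (n - 5) 0 \<or> 6 \<le> n \<and> I 1 (n - 5) 0 0 \<or>
    5 \<le> n \<and> 44 * int n - 160 < C4_pend_per p q r s"
proof -
  have rot: "C4_pend_per q r s p = C4_pend_per p q r s" "C4_pend_per r s p q = C4_pend_per p q r s"
    "C4_pend_per s p q r = C4_pend_per p q r s"
    using C4_pend_per_rotate by metis+
  have opposite: ?thesis
    if x: "(x, 0, y, 0) \<in> {(p, q, r, s), (q, r, s, p), (r, s, p, q), (s, p, q, r)}" for x y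
  proof -
    have nxy: "n = 4 + x + y" using n x by auto
    have per: "C4_pend_per p q r s = C4_pend_per x 0 y 0"
      using x rot by auto
    have Is: "I x 0 y 0" "I 0 y 0 x" "I y 0 x 0" "I 0 x 0 y" using x by (auto intro!: I)
    consider "x = 0" | "y = 0" | "x = 1" "1 \<le> y" | "y = 1" "1 \<le> x" | "2 \<le> x" "2 \<le> y" by linarith
    then show ?thesis
    proof cases
      case 5
      then show ?thesis using C4_pend_per_opposite[of x y] nxy per by simp
    qed (use Is nxy in auto)
  qed
  have adjacent: ?thesis
    if x: "(x, y, 0, 0) \<in> {(p, q, r, s), (q, r, s, p), (r, s, p, q), (s, p, q, r)}"
      and pos: "1 \<le> x" "1 \<le> y" for x y
  proof -
    have nxy: "n = 4 + x + y" using n x by auto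
    have per: "C4_pend_per p q r s = C4_pend_per x y 0 0"
      using x rot by auto
    have Is: "I x y 0 0" "I y x 0 0" using x by (auto intro!: I)
    consider "x = 1" | "y = 1" | "2 \<le> x" "2 \<le> y" using pos by linarith
    then show ?thesis
    proof cases
      case 3
      then show ?thesis using C4_pend_per_adjacent[of x y] nxy per by simp
    qed (use Is nxy pos in auto)
  qed
  \<comment> \<open>By zero pattern: pendants only at opposite vertices; an opposite pair together
    with a third vertex; exactly two adjacent vertices.\<close>
  consider "q = 0" "s = 0" | "p = 0" "r = 0" | "1 \<le> p" "1 \<le> r" "1 \<le> q + s" | "1 \<le> q" "1 \<le> s" "1 \<le> p + r"
    | "1 \<le> p" "1 \<le> q" "r = 0" "s = 0" | "1 \<le> q" "1 \<le> r" "s = 0" "p = 0"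
    | "1 \<le> r" "1 \<le> s" "p = 0" "q = 0" | "1 \<le> s" "1 \<le> p" "q = 0" "r = 0"
    by (cases p; cases q; cases r; cases s) simp_all
  then show ?thesis
  proof cases
    case 1 then show ?thesis by (intro opposite[of p r]) auto
  next
    case 2 then show ?thesis by (intro opposite[of q s]) auto
  next
    case 3 then show ?thesis using C4_pend_per_mixed[of p r q s] n by simp
  next
    case 4 then show ?thesis
      using C4_pend_per_mixed[of q s r p] n unfolding rot(1) by (simp add: ac_simps)
  next
    case 5 then show ?thesis by (intro adjacent[of p q]) auto
  next
    case 6 then show ?thesis by (intro adjacent[of q r]) auto
  next
    case 7 then show ?thesis by (intro adjacent[of r s]) auto
  next
    case 8 then show ?thesis by (intro adjacent[of s p]) auto
  qed
qed

section \<open>The three smallest values\<close>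

lemma bip_unicyclic_cases:
  assumes "n \<ge> 4" "bip_unicyclic n E"
  shows "graph_iso n E (Bgraph 2 (n - 2)) \<or> 6 \<le> n \<and> graph_iso n E (C4_pend 1 0 (n - 5) 0) \<or>
    6 \<le> n \<and> graph_iso n E (Bgraph 3 (n - 3)) \<or> 5 \<le> n \<and> 44 * int n - 160 < lap_per n E"
proof -
  have simple: "simple_graph n E" and uni: "unicyclic n E" and bip: "bipartite n E"
    using assms(2) by (auto simp: bip_unicyclic_def)
  interpret sgraph E by standard (use simple in \<open>auto simp: simple_graph_def symp_def irreflp_def\<close>)
  obtain col :: "nat \<Rightarrow> bool" where col: "\<And>i j. i < n \<Longrightarrow> j < n \<Longrightarrow> E i j \<Longrightarrow> col i \<noteq> col j"
    using bip by (auto simp: bipartite_def)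
  have "adj_rel {..<n} = {(i, j). E i j}" using simple by (auto simp: adj_rel_def simple_graph_def)
  then have "conn {..<n}" using uni by (auto simp: conn_def unicyclic_def connected_graph_def)
  moreover have "edges {..<n} = {(i, j). i < j \<and> j < n \<and> E i j}" by (auto simp: edges_def)
  then have "card (edges {..<n}) = n" using uni by (simp add: unicyclic_def num_edges_def)
  moreover have "0 \<in> {..<n}" using assms(1) by simp
  then have "{..<n} \<noteq> {}" by blast
  ultimately consider a b c d where "pend_C4 {..<n} a b c d" | "heavy {..<n}"
    using unicyclic_cases[of "{..<n}" col] col by auto
  then show ?thesis
  proof cases
    case (1 a b c d)
    let ?p = "npend {..<n} a b c d"
    let ?I = "\<lambda>p q r s. graph_iso n E (C4_pend p q r s)"
    have n: "n = 4 + ?p a + ?p b + ?p c + ?p d" using card_pend_C4[OF 1] by simp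
    have rotations: "pend_C4 {..<n} b c d a" "pend_C4 {..<n} c d a b" "pend_C4 {..<n} d a b c"
      using 1 pend_C4_rotate by blast+
    have iso: "?I (?p v) (?p w) (?p x) (?p y)"
      if "(v, w, x, y) \<in> {(a, b, c, d), (b, c, d, a), (c, d, a, b), (d, a, b, c),
        (a, d, c, b), (b, a, d, c), (c, b, a, d), (d, c, b, a)}" for v w x y
    proof -
      have "pend_C4 {..<n} v w x y"
        using that 1 rotations rotations[THEN pend_C4_reflect] pend_C4_reflect[OF 1]
        by (elim insertE emptyE) simp_all
      moreover have "{v, w, x, y} = {a, b, c, d}" using that by auto
      then have "npend {..<n} v w x y = ?p" by (simp add: npend_def fun_eq_iff)
      ultimately have "pend_C4 {..<n} v w x y" "npend {..<n} v w x y = ?p" by simp_all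
      then show ?thesis using graph_iso_C4_pend[OF sgraph_axioms, of n v w x y] by simp
    qed
    have "lap_per n E = C4_pend_per (?p a) (?p b) (?p c) (?p d)"
      using lap_per_iso[OF iso[of a b c d]] lap_per_C4_pend[OF n] by simp
    moreover have "?I 0 (n - 4) 0 0 \<or> 6 \<le> n \<and> ?I 1 0 (n - 5) 0 \<or> 6 \<le> n \<and> ?I 1 (n - 5) 0 0 \<or>
        5 \<le> n \<and> 44 * int n - 160 < C4_pend_per (?p a) (?p b) (?p c) (?p d)"
      by (rule pend_distribution_cases[OF n]) (use iso in auto)
    ultimately show ?thesis by (simp add: Bgraph_def)
  next
    case 2
    then show ?thesis using lap_per_eq_lper[OF simple bip] by (simp add: heavy_def)
  qed
qed

theorem theorem3p9:
  fixes n :: nat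
  assumes "n \<ge> 4"
  shows "(\<forall>E. bip_unicyclic n E \<longrightarrow>
            lap_per n E \<ge> 24 * int n - 60 \<and>
            (lap_per n E = 24 * int n - 60 \<longleftrightarrow> graph_iso n E (Bgraph 2 (n - 2))))
       \<and> (n \<ge> 6 \<longrightarrow> (\<forall>E. bip_unicyclic n E \<and> \<not> graph_iso n E (Bgraph 2 (n - 2)) \<longrightarrow>
            lap_per n E \<ge> 40 * int n - 140 \<and>
            (lap_per n E = 40 * int n - 140 \<longleftrightarrow> graph_iso n E (C4_pend 1 0 (n - 5) 0))))
       \<and> (n \<ge> 6 \<longrightarrow> (\<forall>E. bip_unicyclic n E \<and> \<not> graph_iso n E (Bgraph 2 (n - 2))
               \<and> \<not> graph_iso n E (C4_pend 1 0 (n - 5) 0) \<longrightarrow>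
            lap_per n E \<ge> 44 * int n - 160 \<and>
            (lap_per n E = 44 * int n - 160 \<longleftrightarrow> graph_iso n E (Bgraph 3 (n - 3)))))"
proof -
  have v1: "lap_per n E = 24 * int n - 60" if "graph_iso n E (Bgraph 2 (n - 2))" for E
    using lap_per_iso[OF that] lap_per_C4_pend[of n 0 "n - 4" 0 0] assms
    by (simp add: Bgraph_def C4_pend_per_expand of_nat_diff)
  have v2: "lap_per n E = 40 * int n - 140" if "6 \<le> n" "graph_iso n E (C4_pend 1 0 (n - 5) 0)" for E
    using lap_per_iso[OF that(2)] lap_per_C4_pend[of n 1 0 "n - 5" 0] that(1)
    by (simp add: C4_pend_per_expand of_nat_diff)
  have v3: "lap_per n E = 44 * int n - 160" if "6 \<le> n" "graph_iso n E (Bgraph 3 (n - 3))" for E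
    using lap_per_iso[OF that(2)] lap_per_C4_pend[of n 1 "n - 5" 0 0] that(1)
    by (simp add: Bgraph_def C4_pend_per_expand of_nat_diff)
  note cases = bip_unicyclic_cases[OF assms]
  \<comment> \<open>In the last alternative \<open>5 \<le> n\<close> is what makes
    \<open>44 n - 160\<close> at least \<open>24 n - 60\<close>; the strict gaps to the second and
    third values come from \<open>6 \<le> n\<close>.\<close>
  have 1: "24 * int n - 60 < lap_per n E"
    if "bip_unicyclic n E" "\<not> graph_iso n E (Bgraph 2 (n - 2))" for E
    using cases[OF that(1)] that(2) v2[of E] v3[of E] by linarith
  have 2: "40 * int n - 140 < lap_per n E"
    if "6 \<le> n" "bip_unicyclic n E" "\<not> graph_iso n E (Bgraph 2 (n - 2))"
      "\<not> graph_iso n E (C4_pend 1 0 (n - 5) 0)" for E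
    using cases[OF that(2)] that v3[of E] by linarith
  have 3: "44 * int n - 160 < lap_per n E"
    if "bip_unicyclic n E" "\<not> graph_iso n E (Bgraph 2 (n - 2))"
      "\<not> graph_iso n E (C4_pend 1 0 (n - 5) 0)" "\<not> graph_iso n E (Bgraph 3 (n - 3))" for E
    using cases[OF that(1)] that by blast
  show ?thesis
  proof (intro conjI allI impI; (elim conjE)?)
    fix E assume E: "bip_unicyclic n E"
    show "24 * int n - 60 \<le> lap_per n E"
      "lap_per n E = 24 * int n - 60 \<longleftrightarrow> graph_iso n E (Bgraph 2 (n - 2))"
      using v1[of E] 1[OF E] by linarith+
    assume n6: "6 \<le> n" and ne: "\<not> graph_iso n E (Bgraph 2 (n - 2))"
    show "40 * int n - 140 \<le> lap_per n E"
      "lap_per n E = 40 * int n - 140 \<longleftrightarrow> graph_iso n E (C4_pend 1 0 (n - 5) 0)"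
      using v2[of E, OF n6] 2[OF n6 E ne] by linarith+
    assume ne': "\<not> graph_iso n E (C4_pend 1 0 (n - 5) 0)"
    show "44 * int n - 160 \<le> lap_per n E"
      "lap_per n E = 44 * int n - 160 \<longleftrightarrow> graph_iso n E (Bgraph 3 (n - 3))"
      using v3[of E, OF n6] 3[OF E ne ne'] by linarith+
  qed
qed

end
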